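(* Let $g \in L^2(\mathbb{R})$ be such that $1/Zg \notin L^2(Q)$, where $Q=[0,1)^2$ and $Z$ is the Zak transform. If there is some point $(x_0,\xi_0) \in Q$ such that $\rho_{x_0,\xi_0}/Zg \in L^2(Q)$, then the Gabor system $G\bigl(g,\mathbb{Z}^2 \setminus \{(a,b)\}\bigr)$ is exact in $L^2(\mathbb{R})$ for every pair $(a,b) \in \mathbb{Z}^2$. However, there is no ordering of $\mathbb{Z}^2 \setminus \{(a,b)\}$ for which this system is a Schauder basis for $L^2(\mathbb{R})$.
   Context: The Zak transform is the unitary map $Z:L^2(\mathbb{R})\to L^2(Q)$, $Zf(x,\xi)=\sum_{j\in\mathbb{Z}} f(x-j)\,e^{2\pi i j\xi}$ for $(x,\xi)\in Q$, where the series converges unconditionally in the norm of $L^2(Q)$. For $(x_0,\xi_0)\in Q$, $\rho_{x_0,\xi_0}(x,\xi)=\sqrt{(x-x_0)^2+(\xi-\xi_0)^2}$. For $g\in L^2(\mathbb{R})$ and countable $\Lambda\subseteq\mathbb{R}^2$, the Gabor system is $G(g,\Lambda)=\{M_\xi T_x g\}_{(x,\xi)\in\Lambda}$, where $(M_\xi T_x g)(t)=e^{2\pi i\xi t}g(t-x)$. A countable family in a Hilbert space is complete if its finite linear span is dense; minimal if no element lies in the closed linear span of the other elements; exact if both complete and minimal. A family $\{f_i\}_{i\in I}$ is a Schauder basis with respect to an ordering (enumeration) of $I$ if for each $f$ in the space there exist unique scalars $c_i$ such that $f=\sum_{i\in I} c_i f_i$ with the partial sums in that ordering converging in norm. *)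

theory Defs
  imports "HOL-Analysis.Analysis"
begin

text \<open>
  Elements of \<open>L\<^sup>2\<close> are represented by square-integrable functions; functions that agree almost
  everywhere are not identified, and \<open>L2_norm\<close> is accordingly a seminorm. All notions below
  only depend on almost-everywhere classes. Every almost-everywhere class of Lebesgue measurable
  functions contains a Borel function, so \<open>lborel\<close> gives the usual \<open>L\<^sup>2\<close> spaces.
\<close>

definition L2 :: "'a measure \<Rightarrow> ('a \<Rightarrow> complex) set" where
  "L2 M = {f \<in> borel_measurable M. integrable M (\<lambda>x. (cmod (f x))\<^sup>2)}"

definition L2_norm :: "'a measure \<Rightarrow> ('a \<Rightarrow> complex) \<Rightarrow> real" where
  "L2_norm M f = sqrt (\<integral>x. (cmod (f x))\<^sup>2 \<partial>M)"

text \<open>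
  Since \<open>z / 0 = 0\<close> in HOL, \<open>h / F \<in> L\<^sup>2\<close> must also say that the quotient is defined almost
  everywhere; where \<open>F\<close> vanishes on a set of positive measure, \<open>h / F\<close> is not in \<open>L\<^sup>2\<close>.
\<close>

definition quotient_in_L2 :: "'a measure \<Rightarrow> ('a \<Rightarrow> complex) \<Rightarrow> ('a \<Rightarrow> complex) \<Rightarrow> bool" where
  "quotient_in_L2 M h F \<longleftrightarrow> (AE p in M. F p \<noteq> 0) \<and> (\<lambda>p. h p / F p) \<in> L2 M"

definition closed_span :: "'a measure \<Rightarrow> 'i set \<Rightarrow> ('i \<Rightarrow> 'a \<Rightarrow> complex) \<Rightarrow> ('a \<Rightarrow> complex) set" where
  "closed_span M I \<phi> = {f \<in> L2 M. \<forall>\<epsilon>>0. \<exists>J c. finite J \<and> J \<subseteq> I \<and>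
     L2_norm M (\<lambda>x. f x - (\<Sum>i\<in>J. c i * \<phi> i x)) < \<epsilon>}"

definition complete_system :: "'a measure \<Rightarrow> 'i set \<Rightarrow> ('i \<Rightarrow> 'a \<Rightarrow> complex) \<Rightarrow> bool" where
  "complete_system M I \<phi> \<longleftrightarrow> closed_span M I \<phi> = L2 M"

definition minimal_system :: "'a measure \<Rightarrow> 'i set \<Rightarrow> ('i \<Rightarrow> 'a \<Rightarrow> complex) \<Rightarrow> bool" where
  "minimal_system M I \<phi> \<longleftrightarrow> (\<forall>i\<in>I. \<phi> i \<notin> closed_span M (I - {i}) \<phi>)"

definition exact_system :: "'a measure \<Rightarrow> 'i set \<Rightarrow> ('i \<Rightarrow> 'a \<Rightarrow> complex) \<Rightarrow> bool" where
  "exact_system M I \<phi> \<longleftrightarrow>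
     (\<forall>i\<in>I. \<phi> i \<in> L2 M) \<and> complete_system M I \<phi> \<and> minimal_system M I \<phi>"

text \<open>
  An ordering is an enumeration \<open>\<sigma>\<close> of the (countably infinite) index set; \<open>c n\<close> is the
  coefficient of \<open>\<phi> (\<sigma> n)\<close>.
\<close>

definition schauder_basis_wrt :: "'a measure \<Rightarrow> (nat \<Rightarrow> 'i) \<Rightarrow> ('i \<Rightarrow> 'a \<Rightarrow> complex) \<Rightarrow> bool" where
  "schauder_basis_wrt M \<sigma> \<phi> \<longleftrightarrow>
     (\<forall>f\<in>L2 M. \<exists>!c. (\<lambda>N. L2_norm M (\<lambda>x. f x - (\<Sum>n<N. c n * \<phi> (\<sigma> n) x))) \<longlonglongrightarrow> 0)"

definition translation :: "real \<Rightarrow> (real \<Rightarrow> complex) \<Rightarrow> real \<Rightarrow> complex" where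
  "translation x f t = f (t - x)"

definition modulation :: "real \<Rightarrow> (real \<Rightarrow> complex) \<Rightarrow> real \<Rightarrow> complex" where
  "modulation \<xi> f t = cis (2 * pi * \<xi> * t) * f t"

text \<open>The Gabor system \<open>G(g,\<Lambda>)\<close> is the family \<open>gabor g\<close> restricted to the index set \<open>\<Lambda>\<close>.\<close>

definition gabor :: "(real \<Rightarrow> complex) \<Rightarrow> real \<times> real \<Rightarrow> real \<Rightarrow> complex" where
  "gabor g = (\<lambda>(x, \<xi>). modulation \<xi> (translation x g))"

definition Q :: "(real \<times> real) set" where
  "Q = {0..<1} \<times> {0..<1}"

abbreviation lborel_Q :: "(real \<times> real) measure" where
  "lborel_Q \<equiv> restrict_space lborel Q"

text \<open>
  Unconditional convergence of the Zak series in the norm of \<open>L\<^sup>2(Q)\<close> is convergence along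
  the net of finite subsets of the integers.
\<close>

definition has_zak_transform ::
  "(real \<Rightarrow> complex) \<Rightarrow> (real \<times> real \<Rightarrow> complex) \<Rightarrow> bool" where
  "has_zak_transform f F \<longleftrightarrow> F \<in> L2 lborel_Q \<and>
     ((\<lambda>J. L2_norm lborel_Q
         (\<lambda>(x, \<xi>). F (x, \<xi>) - (\<Sum>j\<in>J. f (x - of_int j) * cis (2 * pi * of_int j * \<xi>))))
       \<longlongrightarrow> 0) (finite_subsets_at_top (UNIV :: int set))"

text \<open>
  For \<open>f \<in> L\<^sup>2\<close> the sum of the series is determined up to a null set; \<open>zak f\<close> is one of its
  representatives.
\<close>

definition zak :: "(real \<Rightarrow> complex) \<Rightarrow> real \<times> real \<Rightarrow> complex" where
  "zak f = (SOME F. has_zak_transform f F)"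

definition rho :: "real \<times> real \<Rightarrow> real \<times> real \<Rightarrow> real" where
  "rho = (\<lambda>(x\<^sub>0, \<xi>\<^sub>0) (x, \<xi>). sqrt ((x - x\<^sub>0)\<^sup>2 + (\<xi> - \<xi>\<^sub>0)\<^sup>2))"

end

theory Submission
  imports Defs
begin

text \<open>
  The Zak transform maps the Gabor system to the products of \<open>G = Zg\<close> with the characters \<open>e\<^sub>n\<close> of the
  torus. Trigonometric polynomials are dense in \<open>L\<^sup>2\<close> of the finite measure \<open>(1 + |G|\<^sup>2) dp\<close>, and as
  \<open>1/G \<notin> L\<^sup>2\<close> one of the characters can be omitted without losing the density of the span of the \<open>e\<^sub>n G\<close>.
  The remaining \<open>e\<^sub>m G\<close> have the biorthogonal system \<open>h\<^sub>m = (e\<^sub>m - \<kappa> e\<^sub>n\<^sub>0) / cnj G\<close>, where the constant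
  \<open>\<kappa>\<close> makes the numerator vanish at the point \<open>p\<^sub>0\<close>, so that \<open>h\<^sub>m \<in> L\<^sup>2\<close>; this gives minimality. In
  a Schauder basis with elements of equal norm all coefficient sequences are bounded, hence the
  \<open>h\<^sub>m\<close> are bounded in norm by the uniform boundedness principle. But averaging \<open>|h\<^sub>m|\<^sup>2\<close> over \<open>m\<close>
  turns such a bound into one for \<open>\<integral> 2 / |G|\<^sup>2\<close>, which is infinite.
\<close>

subsection \<open>Square-integrable functions\<close>

text \<open>Density survives the omission of a character for the reason that the kernel of an
  unbounded functional is dense: as \<open>1/G\<close> is not in \<open>L2\<close>, the Fourier
  coefficient of \<open>F / G\<close> at \<open>n0\<close> cannot be bounded by the norm of
  \<open>F\<close>. For the full system the only candidates for biorthogonal functions are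
  \<open>e\<^sub>m / cnj G\<close>, which are not square-integrable. The hypothesis on
  \<open>rho\<close> confines the singularity of \<open>1/G\<close> to one point, where a
  first-order zero repairs it. Characters are Lipschitz, so a correction by
  \<open>e\<^sub>n\<^sub>0\<close> supplies this zero, and the remaining elements do not see the
  correction because \<open>n0\<close> is absent. The Lipschitz constants grow with
  \<open>m\<close>, which leaves room for unbounded norms. Approximation errors move between the
  line and the square by isometry alone. Uniform boundedness, however, tests the
  \<open>h\<^sub>m\<close> against all of \<open>L2\<close> of the square; the surjectivity that
  this calls for is derived from completeness on the square.\<close>

lemma borel_measurable_cnj [measurable]: "cnj \<in> borel_measurable borel"
  by (intro borel_measurable_continuous_onI continuous_intros)

lemma L2_I: "f \<in> borel_measurable M \<Longrightarrow> integrable M (\<lambda>x. (cmod (f x))\<^sup>2) \<Longrightarrow> f \<in> L2 M"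
  by (simp add: L2_def)

lemma L2_measurable [measurable_dest]: "f \<in> L2 M \<Longrightarrow> f \<in> borel_measurable M"
  by (simp add: L2_def)

lemma L2_integrable: "f \<in> L2 M \<Longrightarrow> integrable M (\<lambda>x. (cmod (f x))\<^sup>2)"
  by (simp add: L2_def)

lemma L2_norm_nonneg [simp]: "L2_norm M f \<ge> 0"
  by (simp add: L2_norm_def)

lemma L2_norm_square: "(L2_norm M f)\<^sup>2 = (\<integral>x. (cmod (f x))\<^sup>2 \<partial>M)"
  by (simp add: L2_norm_def)

lemma L2_norm_zero_iff:
  assumes "f \<in> L2 M"
  shows "L2_norm M f = 0 \<longleftrightarrow> (AE x in M. f x = 0)"
  using integral_nonneg_eq_0_iff_AE[OF L2_integrable[OF assms]] by (simp add: L2_norm_def)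

lemma L2_bound:
  assumes "f \<in> borel_measurable M" "w \<in> L2 M" "AE x in M. cmod (f x) \<le> cmod (w x)"
  shows "f \<in> L2 M"
proof (rule L2_I)
  show "integrable M (\<lambda>x. (cmod (f x))\<^sup>2)"
    by (rule Bochner_Integration.integrable_bound[OF L2_integrable[OF assms(2)]])
       (use assms in \<open>auto elim!: eventually_mono intro!: power_mono\<close>)
qed fact

lemma L2_norm_mono:
  assumes "f \<in> borel_measurable M" "w \<in> L2 M" "AE x in M. cmod (f x) \<le> cmod (w x)"
  shows "L2_norm M f \<le> L2_norm M w"
  unfolding L2_norm_def
  by (intro real_sqrt_le_mono integral_mono_AE L2_integrable L2_bound[OF assms] assms(2))
     (use assms(3) in \<open>auto elim!: eventually_mono intro!: power_mono\<close>)

lemma L2_norm_cong: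
  assumes "\<And>x. x \<in> space M \<Longrightarrow> cmod (f x) = cmod (h x)"
  shows "L2_norm M f = L2_norm M h"
  unfolding L2_norm_def using assms by (auto intro!: Bochner_Integration.integral_cong)

lemma L2_cmod:
  assumes "f \<in> L2 M"
  shows "(\<lambda>x. of_real (cmod (f x))) \<in> L2 M"
  by (rule L2_bound[OF _ assms]) (use assms in auto)

lemma L2_norm_cmod: "L2_norm M (\<lambda>x. of_real (cmod (f x))) = L2_norm M f"
  by (simp add: L2_norm_def)

lemma L2_scale:
  assumes "f \<in> L2 M"
  shows "(\<lambda>x. c * f x) \<in> L2 M"
  using assms by (auto simp: L2_def norm_mult power_mult_distrib)

lemma L2_norm_scale: "L2_norm M (\<lambda>x. c * f x) = cmod c * L2_norm M f"
  by (simp add: L2_norm_def norm_mult power_mult_distrib real_sqrt_mult)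

lemma L2_add:
  assumes "f \<in> L2 M" "h \<in> L2 M"
  shows "(\<lambda>x. f x + h x) \<in> L2 M"
proof (rule L2_I)
  have "integrable M (\<lambda>x. 2 * (cmod (f x))\<^sup>2 + 2 * (cmod (h x))\<^sup>2)"
    using assms[THEN L2_integrable] by simp
  moreover have "norm ((cmod (f x + h x))\<^sup>2) \<le> norm (2 * (cmod (f x))\<^sup>2 + 2 * (cmod (h x))\<^sup>2)" for x
  proof -
    have "(cmod (f x + h x))\<^sup>2 \<le> (cmod (f x) + cmod (h x))\<^sup>2"
      by (intro power_mono norm_triangle_ineq) auto
    also have "\<dots> \<le> 2 * (cmod (f x))\<^sup>2 + 2 * (cmod (h x))\<^sup>2"
      using zero_le_power2[of "cmod (f x) - cmod (h x)"]
      by (simp add: power2_sum power2_diff)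
    finally show ?thesis by simp
  qed
  ultimately show "integrable M (\<lambda>x. (cmod (f x + h x))\<^sup>2)"
    using assms by (elim Bochner_Integration.integrable_bound) auto
qed (use assms in measurable)

lemma L2_diff:
  assumes "f \<in> L2 M" "h \<in> L2 M"
  shows "(\<lambda>x. f x - h x) \<in> L2 M"
  using L2_add[OF assms(1) L2_scale[OF assms(2), of "-1"]] by simp

lemma L2_zero: "(\<lambda>x. 0) \<in> L2 M"
  by (simp add: L2_def)

lemma L2_sum:
  assumes "\<And>i. i \<in> J \<Longrightarrow> f i \<in> L2 M"
  shows "(\<lambda>x. \<Sum>i\<in>J. f i x) \<in> L2 M"
  using assms by (induction J rule: infinite_finite_induct) (auto intro: L2_zero L2_add)

lemma L2_mult_cnj_integrable:
  assumes "f \<in> L2 M" "h \<in> L2 M"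
  shows "integrable M (\<lambda>x. f x * cnj (h x))"
proof (rule Bochner_Integration.integrable_bound)
  show "integrable M (\<lambda>x. (cmod (f x))\<^sup>2 + (cmod (h x))\<^sup>2)"
    using assms[THEN L2_integrable] by simp
  have "cmod (f x) * cmod (h x) \<le> (cmod (f x))\<^sup>2 + (cmod (h x))\<^sup>2" for x
    using sum_squares_bound[of "cmod (f x)" "cmod (h x)"]
      mult_nonneg_nonneg[OF norm_ge_zero[of "f x"] norm_ge_zero[of "h x"]] by linarith
  then show "AE x in M. norm (f x * cnj (h x)) \<le> norm ((cmod (f x))\<^sup>2 + (cmod (h x))\<^sup>2)"
    by (auto simp: norm_mult)
qed (use assms in measurable)

text \<open>The integral of \<open>(s |f| - t |h|)\<^sup>2\<close> is non-negative; taking for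
  \<open>s\<close> the norm of \<open>h\<close> and for \<open>t\<close> that of \<open>f\<close>
  makes both square terms equal. The final division needs positive norms, so a vanishing norm is
  treated separately through almost-everywhere equality.\<close>

lemma L2_Cauchy_Schwarz_norm:
  assumes "f \<in> L2 M" "h \<in> L2 M"
  shows "(\<integral>x. cmod (f x) * cmod (h x) \<partial>M) \<le> L2_norm M f * L2_norm M h"
proof -
  define a where "a = L2_norm M f"
  define b where "b = L2_norm M h"
  define p where "p = (\<integral>x. cmod (f x) * cmod (h x) \<partial>M)"
  have int: "integrable M (\<lambda>x. cmod (f x) * cmod (h x))"
    using integrable_norm[OF L2_mult_cnj_integrable[OF assms]] by (simp add: norm_mult)
  have quad: "2 * s * t * p \<le> s\<^sup>2 * a\<^sup>2 + t\<^sup>2 * b\<^sup>2" for s t :: real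
  proof -
    have "0 \<le> (\<integral>x. (s * cmod (f x) - t * cmod (h x))\<^sup>2 \<partial>M)"
      by (intro integral_nonneg_AE) auto
    also have "\<dots> = (\<integral>x. s\<^sup>2 * (cmod (f x))\<^sup>2 + t\<^sup>2 * (cmod (h x))\<^sup>2 - 2 * s * t * (cmod (f x) * cmod (h x)) \<partial>M)"
      by (simp add: power2_diff power_mult_distrib algebra_simps)
    also have "\<dots> = s\<^sup>2 * a\<^sup>2 + t\<^sup>2 * b\<^sup>2 - 2 * s * t * p"
      using int assms[THEN L2_integrable] by (simp add: a_def b_def p_def L2_norm_square)
    finally show ?thesis by simp
  qed
  have "a \<ge> 0" "b \<ge> 0" by (auto simp: a_def b_def)
  have "p \<le> a * b"
  proof (cases "a = 0 \<or> b = 0")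
    case True
    then have "AE x in M. f x = 0 \<or> h x = 0"
      using assms[THEN L2_norm_zero_iff] by (auto simp: a_def b_def elim: eventually_mono)
    then have "p = (\<integral>x. 0 \<partial>M)"
      unfolding p_def using assms by (intro integral_cong_AE) (auto elim: eventually_mono)
    with \<open>a \<ge> 0\<close> \<open>b \<ge> 0\<close> show ?thesis by simp
  next
    case False
    with \<open>a \<ge> 0\<close> \<open>b \<ge> 0\<close> have pos: "a * b > 0" by simp
    have "2 * (a * b) * p \<le> 2 * (a * b) * (a * b)"
      using quad[of b a] by (simp add: power2_eq_square algebra_simps)
    with pos show ?thesis using mult_le_cancel_left_pos[of "2 * (a * b)" p "a * b"] by simp
  qed
  then show ?thesis by (simp add: a_def b_def p_def)
qed

lemma L2_Cauchy_Schwarz: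
  assumes "f \<in> L2 M" "h \<in> L2 M"
  shows "cmod (\<integral>x. f x * cnj (h x) \<partial>M) \<le> L2_norm M f * L2_norm M h"
  using integral_norm_bound[of M "\<lambda>x. f x * cnj (h x)"] L2_Cauchy_Schwarz_norm[OF assms]
  by (simp add: norm_mult)

lemma L2_norm_triangle:
  assumes "f \<in> L2 M" "h \<in> L2 M"
  shows "L2_norm M (\<lambda>x. f x + h x) \<le> L2_norm M f + L2_norm M h"
proof (rule power2_le_imp_le)
  have int: "integrable M (\<lambda>x. cmod (f x) * cmod (h x))"
    using integrable_norm[OF L2_mult_cnj_integrable[OF assms]] by (simp add: norm_mult)
  have "(L2_norm M (\<lambda>x. f x + h x))\<^sup>2 = (\<integral>x. (cmod (f x + h x))\<^sup>2 \<partial>M)"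
    by (rule L2_norm_square)
  also have "\<dots> \<le> (\<integral>x. (cmod (f x))\<^sup>2 + (cmod (h x))\<^sup>2 + 2 * (cmod (f x) * cmod (h x)) \<partial>M)"
  proof (rule integral_mono)
    show "integrable M (\<lambda>x. (cmod (f x + h x))\<^sup>2)"
      by (rule L2_integrable[OF L2_add[OF assms]])
    show "(cmod (f x + h x))\<^sup>2 \<le> (cmod (f x))\<^sup>2 + (cmod (h x))\<^sup>2 + 2 * (cmod (f x) * cmod (h x))" for x
      using power_mono[OF norm_triangle_ineq[of "f x" "h x"], of 2] by (simp add: power2_sum)
  qed (use int assms[THEN L2_integrable] in auto)
  also have "\<dots> = (L2_norm M f)\<^sup>2 + (L2_norm M h)\<^sup>2 + 2 * (\<integral>x. cmod (f x) * cmod (h x) \<partial>M)"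
    using int assms[THEN L2_integrable] by (simp add: L2_norm_square)
  also have "\<dots> \<le> (L2_norm M f + L2_norm M h)\<^sup>2"
    using L2_Cauchy_Schwarz_norm[OF assms] by (simp add: power2_sum)
  finally show "(L2_norm M (\<lambda>x. f x + h x))\<^sup>2 \<le> (L2_norm M f + L2_norm M h)\<^sup>2" .
qed auto

lemma L2_norm_minus_commute: "L2_norm M (\<lambda>x. f x - h x) = L2_norm M (\<lambda>x. h x - f x)"
  by (simp add: L2_norm_def norm_minus_commute)

lemma L2_norm_triangle_diff:
  assumes "f \<in> L2 M" "h \<in> L2 M" "k \<in> L2 M"
  shows "L2_norm M (\<lambda>x. f x - k x) \<le> L2_norm M (\<lambda>x. f x - h x) + L2_norm M (\<lambda>x. h x - k x)"
  using L2_norm_triangle[OF L2_diff[OF assms(1,2)] L2_diff[OF assms(2,3)]] by simp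

lemma L2_norm_triangle_minus:
  assumes "f \<in> L2 M" "h \<in> L2 M"
  shows "\<bar>L2_norm M f - L2_norm M h\<bar> \<le> L2_norm M (\<lambda>x. f x - h x)"
  using L2_norm_triangle[OF L2_diff[OF assms] assms(2)]
    L2_norm_triangle[OF L2_diff[OF assms(2,1)] assms(1)] L2_norm_minus_commute[of M f h] by simp

lemma L2_norm_sum:
  assumes "finite J" "\<And>i. i \<in> J \<Longrightarrow> f i \<in> L2 M"
  shows "L2_norm M (\<lambda>x. \<Sum>i\<in>J. f i x) \<le> (\<Sum>i\<in>J. L2_norm M (f i))"
  using assms
proof (induction J rule: finite_induct)
  case empty
  then show ?case by (simp add: L2_norm_def)
next
  case (insert i J)
  have "L2_norm M (\<lambda>x. f i x + (\<Sum>j\<in>J. f j x)) \<le> L2_norm M (f i) + L2_norm M (\<lambda>x. \<Sum>j\<in>J. f j x)"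
    using insert.prems by (intro L2_norm_triangle L2_sum) auto
  with insert show ?case by force
qed

section \<open>Dominated convergence and completeness of \<open>L2\<close>\<close>

lemma L2_dominated_convergence:
  assumes "\<And>n. f n \<in> borel_measurable M" "F \<in> borel_measurable M" "w \<in> L2 M"
    and "AE x in M. (\<lambda>n. f n x) \<longlonglongrightarrow> F x"
    and "\<And>n. AE x in M. cmod (f n x) \<le> cmod (w x)"
  shows "F \<in> L2 M" and "(\<lambda>n. L2_norm M (\<lambda>x. f n x - F x)) \<longlonglongrightarrow> 0"
proof -
  have "AE x in M. \<forall>n. cmod (f n x) \<le> cmod (w x)"
    using assms(5) by (simp add: AE_all_countable)
  with assms(4) have bF: "AE x in M. cmod (F x) \<le> cmod (w x)"
    by eventually_elim (auto intro: Lim_bounded tendsto_norm)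
  then show "F \<in> L2 M" by (intro L2_bound[OF assms(2,3)])
  have "(\<lambda>n. \<integral>x. (cmod (f n x - F x))\<^sup>2 \<partial>M) \<longlonglongrightarrow> (\<integral>x. 0 \<partial>M)"
  proof (rule integral_dominated_convergence)
    show "integrable M (\<lambda>x. 4 * (cmod (w x))\<^sup>2)"
      using L2_integrable[OF assms(3)] by simp
    show "AE x in M. (\<lambda>n. (cmod (f n x - F x))\<^sup>2) \<longlonglongrightarrow> 0"
      using assms(4)
    proof eventually_elim
      case (elim x)
      then have "(\<lambda>n. (cmod (f n x - F x))\<^sup>2) \<longlonglongrightarrow> (cmod (F x - F x))\<^sup>2"
        by (intro tendsto_intros)
      then show ?case by simp
    qed
    show "AE x in M. norm ((cmod (f n x - F x))\<^sup>2) \<le> 4 * (cmod (w x))\<^sup>2" for n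
      using assms(5)[of n] bF
    proof eventually_elim
      case (elim x)
      have "cmod (f n x - F x) \<le> 2 * cmod (w x)"
        using norm_triangle_ineq4[of "f n x" "F x"] elim by linarith
      from power_mono[OF this, of 2] show ?case by (simp add: power_mult_distrib)
    qed
  qed (use assms(1,2) in auto)
  then have "(\<lambda>n. sqrt (\<integral>x. (cmod (f n x - F x))\<^sup>2 \<partial>M)) \<longlonglongrightarrow> sqrt 0"
    by (intro tendsto_real_sqrt) simp
  then show "(\<lambda>n. L2_norm M (\<lambda>x. f n x - F x)) \<longlonglongrightarrow> 0"
    by (simp add: L2_norm_def)
qed

text \<open>The Riesz-Fischer argument. A summable bound on the steps replaces the Cauchy condition,
  so no subsequence has to be extracted; each application supplies a sequence with geometrically
  small steps.\<close>

theorem L2_complete: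
  assumes f: "\<And>n. f n \<in> L2 M"
    and fast: "\<And>n. L2_norm M (\<lambda>x. f (Suc n) x - f n x) \<le> d n" and "summable d"
  obtains F where "F \<in> L2 M" "(\<lambda>n. L2_norm M (\<lambda>x. f n x - F x)) \<longlonglongrightarrow> 0"
proof -
  define s where "s n x = cmod (f 0 x) + (\<Sum>k<n. cmod (f (Suc k) x - f k x))" for n x
  have [measurable]: "f n \<in> borel_measurable M" for n using f by auto
  have [measurable]: "s n \<in> borel_measurable M" for n unfolding s_def by measurable
  have s_nonneg: "0 \<le> s n x" for n x unfolding s_def by (simp add: sum_nonneg)
  have s_L2: "(\<lambda>x. complex_of_real (s n x)) \<in> L2 M" for n
    unfolding s_def of_real_add of_real_sum by (intro L2_add L2_sum L2_cmod L2_diff f)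
  have d_nonneg: "0 \<le> d n" for n using fast[of n] L2_norm_nonneg order_trans by blast
  define B where "B = L2_norm M (f 0) + suminf d"
  have s_norm: "L2_norm M (\<lambda>x. complex_of_real (s n x)) \<le> B" for n
  proof -
    have "L2_norm M (\<lambda>x. complex_of_real (s n x))
        \<le> L2_norm M (\<lambda>x. complex_of_real (cmod (f 0 x)))
          + L2_norm M (\<lambda>x. \<Sum>k<n. complex_of_real (cmod (f (Suc k) x - f k x)))"
      unfolding s_def of_real_add of_real_sum
      by (intro L2_norm_triangle L2_sum L2_cmod L2_diff f)
    also have "L2_norm M (\<lambda>x. \<Sum>k<n. complex_of_real (cmod (f (Suc k) x - f k x)))
        \<le> (\<Sum>k<n. L2_norm M (\<lambda>x. complex_of_real (cmod (f (Suc k) x - f k x))))"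
      by (intro L2_norm_sum L2_cmod L2_diff f) auto
    also have "\<dots> \<le> (\<Sum>k<n. d k)"
      unfolding L2_norm_cmod by (intro sum_mono fast)
    also have "\<dots> \<le> suminf d"
      using d_nonneg \<open>summable d\<close> by (intro sum_le_suminf) auto
    finally show ?thesis by (simp add: L2_norm_cmod B_def)
  qed
  have s_mono: "s m x \<le> s n x" if "m \<le> n" for m n x
    unfolding s_def using that by (auto intro!: sum_mono2)
  \<comment> \<open>The supremum is taken in \<open>ennreal\<close>: monotone convergence bounds its
    integral before any finiteness is known, and finiteness almost everywhere is a
    consequence.\<close>
  define S where "S x = (SUP n. ennreal ((s n x)\<^sup>2))" for x
  have "(\<integral>\<^sup>+x. S x \<partial>M) = (SUP n. \<integral>\<^sup>+x. ennreal ((s n x)\<^sup>2) \<partial>M)"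
    unfolding S_def
    by (rule nn_integral_monotone_convergence_SUP)
       (auto simp: incseq_def le_fun_def intro!: ennreal_leI power_mono s_mono s_nonneg)
  also have "\<dots> \<le> ennreal (B\<^sup>2)"
  proof (rule SUP_least)
    fix n
    have "(\<integral>\<^sup>+x. ennreal ((s n x)\<^sup>2) \<partial>M) = ennreal (\<integral>x. (s n x)\<^sup>2 \<partial>M)"
      by (rule nn_integral_eq_integral) (use L2_integrable[OF s_L2[of n]] in auto)
    also have "(\<integral>x. (s n x)\<^sup>2 \<partial>M) = (L2_norm M (\<lambda>x. complex_of_real (s n x)))\<^sup>2"
      by (simp add: L2_norm_square)
    also have "ennreal \<dots> \<le> ennreal (B\<^sup>2)"
      by (intro ennreal_leI power_mono s_norm) auto
    finally show "(\<integral>\<^sup>+x. ennreal ((s n x)\<^sup>2) \<partial>M) \<le> ennreal (B\<^sup>2)" .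
  qed
  finally have S_int: "(\<integral>\<^sup>+x. S x \<partial>M) \<le> ennreal (B\<^sup>2)" .
  have [measurable]: "S \<in> borel_measurable M" unfolding S_def by measurable
  have S_fin: "AE x in M. S x \<noteq> \<infinity>"
    by (rule nn_integral_PInf_AE) (use S_int in \<open>auto simp: top_unique\<close>)
  \<comment> \<open>\<open>enn2real\<close> sends infinity to 0, so \<open>W\<close> is finite
    everywhere, but it majorises the \<open>s n\<close> only off the null set where \<open>S\<close>
    is infinite.\<close>
  define W where "W x = complex_of_real (sqrt (enn2real (S x)))" for x
  have [measurable]: "W \<in> borel_measurable M" unfolding W_def by measurable
  have W_L2: "W \<in> L2 M"
  proof (rule L2_I)
    have "integrable M (\<lambda>x. enn2real (S x))"
    proof (rule integrableI_nonneg)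
      have "(\<integral>\<^sup>+x. ennreal (enn2real (S x)) \<partial>M) = (\<integral>\<^sup>+x. S x \<partial>M)"
        by (rule nn_integral_cong_AE)
           (use S_fin in \<open>auto elim!: eventually_mono simp: ennreal_enn2real_if\<close>)
      then show "(\<integral>\<^sup>+x. ennreal (enn2real (S x)) \<partial>M) < \<infinity>"
        using S_int by (auto simp: ennreal_less_top order_le_less_trans)
    qed auto
    then show "integrable M (\<lambda>x. (cmod (W x))\<^sup>2)"
      by (simp add: W_def)
  qed auto
  have sW: "s n x \<le> cmod (W x)" if "S x \<noteq> \<infinity>" for n x
  proof -
    have "ennreal ((s n x)\<^sup>2) \<le> S x" unfolding S_def by (rule SUP_upper) auto
    then have "(s n x)\<^sup>2 \<le> enn2real (S x)"
      using that by (metis enn2real_ennreal enn2real_mono infinity_ennreal_def less_top zero_le_power2)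
    then show ?thesis
      by (simp add: W_def real_le_rsqrt)
  qed
  have fs: "cmod (f n x) \<le> s n x" for n x
  proof -
    have "f n x = f 0 x + (\<Sum>k<n. f (Suc k) x - f k x)"
      by (subst sum_lessThan_telescope) simp
    then have "cmod (f n x) \<le> cmod (f 0 x) + cmod (\<Sum>k<n. f (Suc k) x - f k x)"
      by (metis norm_triangle_ineq)
    also have "\<dots> \<le> s n x" unfolding s_def by (intro add_left_mono norm_sum)
    finally show ?thesis .
  qed
  define F where "F x = lim (\<lambda>n. f n x)" for x
  have conv: "(\<lambda>n. f n x) \<longlonglongrightarrow> F x" if "S x \<noteq> \<infinity>" for x
  proof -
    have "summable (\<lambda>k. cmod (f (Suc k) x - f k x))"
    proof (rule summableI_nonneg_bounded)
      show "(\<Sum>k<n. cmod (f (Suc k) x - f k x)) \<le> cmod (W x)" for n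
        using sW[OF that, of n] norm_ge_zero[of "f 0 x"] unfolding s_def by linarith
    qed simp
    then have "summable (\<lambda>k. f (Suc k) x - f k x)" by (rule summable_norm_cancel)
    then have "convergent (\<lambda>n. f n x - f 0 x)"
      using sum_lessThan_telescope[of "\<lambda>n. f n x"] by (simp add: summable_iff_convergent)
    then have "convergent (\<lambda>n. f n x)" by (simp add: convergent_diff_const_right_iff)
    then show ?thesis unfolding F_def by (simp add: convergent_LIMSEQ_iff)
  qed
  have [measurable]: "F \<in> borel_measurable M"
    unfolding F_def by (rule borel_measurable_lim_metric) auto
  have "AE x in M. (\<lambda>n. f n x) \<longlonglongrightarrow> F x"
    using S_fin by eventually_elim (rule conv)
  moreover have "AE x in M. cmod (f n x) \<le> cmod (W x)" for n
    using S_fin by eventually_elim (use sW fs order_trans in blast)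
  ultimately show thesis
    using L2_dominated_convergence[of f M F W] W_L2 that by auto
qed


section \<open>Inner products and uniform boundedness\<close>

definition L2_inner :: "'a measure \<Rightarrow> ('a \<Rightarrow> complex) \<Rightarrow> ('a \<Rightarrow> complex) \<Rightarrow> complex" where
  "L2_inner M f h = (\<integral>x. f x * cnj (h x) \<partial>M)"

lemma L2_inner_le: "f \<in> L2 M \<Longrightarrow> h \<in> L2 M \<Longrightarrow> cmod (L2_inner M f h) \<le> L2_norm M f * L2_norm M h"
  unfolding L2_inner_def by (rule L2_Cauchy_Schwarz)

lemma L2_inner_add:
  assumes "f \<in> L2 M" "g \<in> L2 M" "h \<in> L2 M"
  shows "L2_inner M (\<lambda>x. f x + g x) h = L2_inner M f h + L2_inner M g h"
  using assms by (simp add: L2_inner_def ring_distribs L2_mult_cnj_integrable)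

lemma L2_inner_diff:
  assumes "f \<in> L2 M" "g \<in> L2 M" "h \<in> L2 M"
  shows "L2_inner M (\<lambda>x. f x - g x) h = L2_inner M f h - L2_inner M g h"
  using assms by (simp add: L2_inner_def ring_distribs L2_mult_cnj_integrable)

lemma L2_inner_scale: "L2_inner M (\<lambda>x. c * f x) h = c * L2_inner M f h"
  by (simp add: L2_inner_def mult.assoc)

lemma L2_inner_sum:
  assumes "finite J" "\<And>i. i \<in> J \<Longrightarrow> f i \<in> L2 M" "h \<in> L2 M"
  shows "L2_inner M (\<lambda>x. \<Sum>i\<in>J. c i * f i x) h = (\<Sum>i\<in>J. c i * L2_inner M (f i) h)"
  using assms
proof (induction J rule: finite_induct)
  case empty
  then show ?case by (simp add: L2_inner_def)
next
  case (insert i J)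
  then have "L2_inner M (\<lambda>x. c i * f i x + (\<Sum>i\<in>J. c i * f i x)) h
      = L2_inner M (\<lambda>x. c i * f i x) h + L2_inner M (\<lambda>x. \<Sum>i\<in>J. c i * f i x) h"
    by (intro L2_inner_add L2_sum L2_scale) auto
  with insert show ?case by (simp add: L2_inner_scale)
qed

lemma L2_inner_self: "f \<in> L2 M \<Longrightarrow> L2_inner M f f = of_real ((L2_norm M f)\<^sup>2)"
  unfolding L2_inner_def L2_norm_square complex_norm_square[symmetric]
  by (rule integral_of_real[OF L2_integrable])

text \<open>
  Gliding hump without Baire category: the signs in \<open>F (Suc k) = F k \<plusminus> 3\<^sup>-\<^sup>k h\<^sub>k / \<parallel>h\<^sub>k\<parallel>\<close> are chosen
  such that adding the new term does not decrease the pairing with \<open>h\<^sub>k\<close> below \<open>3\<^sup>-\<^sup>k \<parallel>h\<^sub>k\<parallel>\<close>, and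
  all the later terms together can cancel at most half of that.
\<close>

theorem L2_uniform_boundedness:
  fixes h :: "'i \<Rightarrow> 'a \<Rightarrow> complex"
  assumes h: "\<And>i. i \<in> I \<Longrightarrow> h i \<in> L2 M"
    and pointwise: "\<And>F. F \<in> L2 M \<Longrightarrow> \<exists>C. \<forall>i\<in>I. cmod (L2_inner M F (h i)) \<le> C"
  shows "\<exists>C. \<forall>i\<in>I. L2_norm M (h i) \<le> C"
proof (rule ccontr)
  assume "\<not> ?thesis"
  \<comment> \<open>The threshold must outgrow the weights of the series of humps:
    \<open>4 ^ k\<close> against \<open>(1/3) ^ k\<close> leaves \<open>(4/3) ^ k\<close>, which no
    bound on the pairings survives.\<close>
  then have "\<forall>k. \<exists>i\<in>I. L2_norm M (h i) > 4 ^ k" by (meson not_le)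
  then obtain \<nu> where \<nu>: "\<And>k. \<nu> k \<in> I" "\<And>k::nat. L2_norm M (h (\<nu> k)) > 4 ^ k" by metis
  define H where "H k = h (\<nu> k)" for k
  have H: "H k \<in> L2 M" for k using \<nu> h by (simp add: H_def)
  have H_big: "L2_norm M (H k) > 4 ^ k" for k using \<nu> by (simp add: H_def)
  then have H_pos: "L2_norm M (H k) > 0" for k by (rule less_trans[rotated]) simp
  define v where "v k x = of_real (1 / L2_norm M (H k)) * H k x" for k x
  have v: "v k \<in> L2 M" for k unfolding v_def by (intro L2_scale H)
  have v_norm: "L2_norm M (v k) = 1" for k
    unfolding v_def L2_norm_scale using H_pos[of k] by (simp add: norm_divide)
  have v_inner: "L2_inner M (v k) (H k) = of_real (L2_norm M (H k))" for k
    unfolding v_def L2_inner_scale L2_inner_self[OF H]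
    using H_pos[of k] by (simp add: power2_eq_square)
  \<comment> \<open>If the plus sign fails, the minus sign works: the two candidate pairings with
    \<open>H k\<close> differ by twice the required size.\<close>
  define r where "r k P = (if cmod (L2_inner M P (H k) + of_real ((1/3) ^ k * L2_norm M (H k)))
      \<ge> (1/3) ^ k * L2_norm M (H k) then (1/3 :: real) ^ k else - ((1/3 :: real) ^ k))" for k P
  define F where "F = rec_nat (\<lambda>x. 0) (\<lambda>k P x. P x + of_real (r k P) * v k x)"
  have F_0: "F 0 = (\<lambda>x. 0)" by (simp add: F_def)
  have F_Suc: "F (Suc k) = (\<lambda>x. F k x + of_real (r k (F k)) * v k x)" for k by (simp add: F_def)
  have F: "F k \<in> L2 M" for k
    by (induction k) (auto simp: F_0 F_Suc intro!: L2_zero L2_add L2_scale v)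
  have F_step: "L2_norm M (\<lambda>x. F (Suc k) x - F k x) = (1/3) ^ k" for k
  proof -
    have "L2_norm M (\<lambda>x. F (Suc k) x - F k x) = L2_norm M (\<lambda>x. of_real (r k (F k)) * v k x)"
      by (simp add: F_Suc)
    also have "\<dots> = (1/3) ^ k" unfolding L2_norm_scale v_norm by (simp add: r_def)
    finally show ?thesis .
  qed
  have F_inner: "cmod (L2_inner M (F (Suc k)) (H k)) \<ge> (1/3) ^ k * L2_norm M (H k)" for k
  proof -
    define b where "b = (1/3) ^ k * L2_norm M (H k)"
    define a where "a = L2_inner M (F k) (H k)"
    have "L2_inner M (F (Suc k)) (H k) = a + of_real (r k (F k)) * of_real (L2_norm M (H k))"
      unfolding F_Suc a_def by (simp add: L2_inner_add L2_inner_scale v_inner F v H L2_scale)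
    also have "\<dots> = (if cmod (a + of_real b) \<ge> b then a + of_real b else a - of_real b)"
      by (simp add: r_def a_def b_def)
    also have "cmod \<dots> \<ge> b"
    proof (cases "cmod (a + of_real b) \<ge> b")
      case False
      have "0 \<le> b" by (simp add: b_def)
      have "2 * b = cmod ((a + of_real b) - (a - of_real b))" using \<open>0 \<le> b\<close> by simp
      also have "\<dots> \<le> cmod (a + of_real b) + cmod (a - of_real b)" by (rule norm_triangle_ineq4)
      finally show ?thesis using False by simp
    qed simp
    finally show ?thesis by (simp add: b_def)
  qed
  obtain G where G: "G \<in> L2 M" and lim: "(\<lambda>n. L2_norm M (\<lambda>x. F n x - G x)) \<longlonglongrightarrow> 0"
    using L2_complete[of F M "\<lambda>k. (1/3) ^ k"] F F_step by (auto simp: summable_geometric)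
  \<comment> \<open>The step norms \<open>(1/3) ^ j\<close> with \<open>j \<ge> m\<close> add up to
    \<open>3/2 * (1/3) ^ m\<close>. At \<open>m = Suc k\<close> this is half of
    \<open>(1/3) ^ k\<close>, the amount secured against \<open>H k\<close>.\<close>
  have F_tail: "L2_norm M (\<lambda>x. F m x - F (m + d) x) \<le> 3/2 * (1/3) ^ m - 3/2 * (1/3) ^ (m + d)" for m d
  proof (induction d)
    case (Suc d)
    have "L2_norm M (\<lambda>x. F m x - F (m + Suc d) x)
        \<le> L2_norm M (\<lambda>x. F m x - F (m + d) x) + L2_norm M (\<lambda>x. F (m + d) x - F (m + Suc d) x)"
      by (intro L2_norm_triangle_diff F)
    also have "L2_norm M (\<lambda>x. F (m + d) x - F (m + Suc d) x) = (1/3) ^ (m + d)"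
      using F_step[of "m + d"] by (subst L2_norm_minus_commute) simp
    finally show ?case using Suc by simp
  qed (simp add: L2_norm_def)
  have FG: "L2_norm M (\<lambda>x. F m x - G x) \<le> 3/2 * (1/3) ^ m" for m
  proof (rule LIMSEQ_le_const)
    show "(\<lambda>d. 3/2 * (1/3) ^ m + L2_norm M (\<lambda>x. F (d + m) x - G x)) \<longlonglongrightarrow> 3/2 * (1/3) ^ m"
      using tendsto_add[OF tendsto_const LIMSEQ_ignore_initial_segment[OF lim]] by simp
    have "L2_norm M (\<lambda>x. F m x - G x) \<le> 3/2 * (1/3) ^ m + L2_norm M (\<lambda>x. F (d + m) x - G x)" for d
    proof -
      have "3/2 * (1/3) ^ m - 3/2 * (1/3) ^ (m + d) \<le> 3/2 * (1/3 :: real) ^ m" by simp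
      with L2_norm_triangle_diff[OF F[of m] F[of "m + d"] G] F_tail[of m d] show ?thesis
        unfolding add.commute[of d m] by linarith
    qed
    then show "\<exists>N. \<forall>d\<ge>N. L2_norm M (\<lambda>x. F m x - G x)
        \<le> 3/2 * (1/3) ^ m + L2_norm M (\<lambda>x. F (d + m) x - G x)" by blast
  qed
  obtain C where "\<forall>i\<in>I. cmod (L2_inner M G (h i)) \<le> C" using pointwise[OF G] by blast
  then have C: "cmod (L2_inner M G (H k)) \<le> C" for k using \<nu> by (simp add: H_def)
  have "(4/3) ^ k \<le> 2 * C" for k
  proof -
    have "cmod (L2_inner M (\<lambda>x. F (Suc k) x - G x) (H k))
        \<le> L2_norm M (\<lambda>x. F (Suc k) x - G x) * L2_norm M (H k)"
      by (intro L2_inner_le L2_diff F G H)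
    also have "\<dots> \<le> (1/3) ^ k / 2 * L2_norm M (H k)"
      using FG[of "Suc k"] by (intro mult_right_mono) auto
    finally have "cmod (L2_inner M (F (Suc k)) (H k) - L2_inner M G (H k)) \<le> (1/3) ^ k / 2 * L2_norm M (H k)"
      by (simp add: L2_inner_diff F G H)
    with F_inner[of k] C[of k] norm_triangle_ineq2[of "L2_inner M (F (Suc k)) (H k)" "L2_inner M G (H k)"]
    have "(1/3) ^ k * L2_norm M (H k) \<le> 2 * C" by linarith
    moreover have "(1/3) ^ k * 4 ^ k \<le> (1/3) ^ k * L2_norm M (H k)"
      using H_big[of k] by (intro mult_left_mono) auto
    ultimately show ?thesis by (simp add: power_mult_distrib[symmetric])
  qed
  moreover obtain k where "(4/3) ^ k > 2 * C"
    using real_arch_pow[of "4/3" "2 * C"] by auto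
  ultimately show False by (meson not_le)
qed

section \<open>Linear spans and their closures\<close>

definition lin_span :: "'i set \<Rightarrow> ('i \<Rightarrow> 'a \<Rightarrow> complex) \<Rightarrow> ('a \<Rightarrow> complex) set" where
  "lin_span I \<phi> = {\<lambda>x. \<Sum>i\<in>J. c i * \<phi> i x |J c. finite J \<and> J \<subseteq> I}"

text \<open>\<open>closed_span\<close> speaks of finite sets and coefficients. Treating the
  approximants as a set of functions lets them be added, scaled and multiplied without handling
  indices.\<close>

lemma closed_span_iff:
  "f \<in> closed_span M I \<phi> \<longleftrightarrow>
    f \<in> L2 M \<and> (\<forall>\<epsilon>>0. \<exists>h\<in>lin_span I \<phi>. L2_norm M (\<lambda>x. f x - h x) < \<epsilon>)"
proof -
  have "(\<exists>h\<in>lin_span I \<phi>. P h) \<longleftrightarrow>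
      (\<exists>J c. finite J \<and> J \<subseteq> I \<and> P (\<lambda>x. \<Sum>i\<in>J. c i * \<phi> i x))" for P
  proof
    assume "\<exists>h\<in>lin_span I \<phi>. P h"
    then obtain h J c where "P h" "finite J" "J \<subseteq> I" "h = (\<lambda>x. \<Sum>i\<in>J. c i * \<phi> i x)"
      unfolding lin_span_def by blast
    then show "\<exists>J c. finite J \<and> J \<subseteq> I \<and> P (\<lambda>x. \<Sum>i\<in>J. c i * \<phi> i x)"
      by (intro exI[of _ J] exI[of _ c]) simp
  next
    assume "\<exists>J c. finite J \<and> J \<subseteq> I \<and> P (\<lambda>x. \<Sum>i\<in>J. c i * \<phi> i x)"
    then obtain J c where "P (\<lambda>x. \<Sum>i\<in>J. c i * \<phi> i x)" "finite J" "J \<subseteq> I" by blast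
    then show "\<exists>h\<in>lin_span I \<phi>. P h"
      by (intro bexI[of _ "\<lambda>x. \<Sum>i\<in>J. c i * \<phi> i x"]) (auto simp: lin_span_def)
  qed
  then show ?thesis by (simp add: closed_span_def)
qed

lemma lin_span_base: "i \<in> I \<Longrightarrow> \<phi> i \<in> lin_span I \<phi>"
  unfolding lin_span_def by (rule CollectI, rule exI[of _ "{i}"], rule exI[of _ "\<lambda>_. 1"]) auto

lemma lin_span_zero: "(\<lambda>x. 0) \<in> lin_span I \<phi>"
  unfolding lin_span_def by (rule CollectI, rule exI[of _ "{}"]) auto

lemma lin_span_scale:
  assumes "f \<in> lin_span I \<phi>"
  shows "(\<lambda>x. a * f x) \<in> lin_span I \<phi>"
proof -
  from assms obtain J c where "finite J" "J \<subseteq> I" "f = (\<lambda>x. \<Sum>i\<in>J. c i * \<phi> i x)"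
    unfolding lin_span_def by blast
  then show ?thesis unfolding lin_span_def
    by (intro CollectI exI[of _ J] exI[of _ "\<lambda>i. a * c i"]) (auto simp: sum_distrib_left mult.assoc)
qed

lemma lin_span_add:
  assumes "f \<in> lin_span I \<phi>" "g \<in> lin_span I \<phi>"
  shows "(\<lambda>x. f x + g x) \<in> lin_span I \<phi>"
proof -
  from assms obtain J c K d where J: "finite J" "J \<subseteq> I" "f = (\<lambda>x. \<Sum>i\<in>J. c i * \<phi> i x)"
    and K: "finite K" "K \<subseteq> I" "g = (\<lambda>x. \<Sum>i\<in>K. d i * \<phi> i x)"
    unfolding lin_span_def by blast
  have eq: "(\<lambda>x. f x + g x) = (\<lambda>x. \<Sum>i\<in>J \<union> K. ((if i \<in> J then c i else 0) + (if i \<in> K then d i else 0)) * \<phi> i x)"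
  proof
    fix x
    have "f x = (\<Sum>i\<in>J \<union> K. (if i \<in> J then c i else 0) * \<phi> i x)"
      unfolding J(3) using J(1) K(1) by (intro sum.mono_neutral_cong_left) auto
    moreover have "g x = (\<Sum>i\<in>J \<union> K. (if i \<in> K then d i else 0) * \<phi> i x)"
      unfolding K(3) using J(1) K(1) by (intro sum.mono_neutral_cong_left) auto
    ultimately show "f x + g x = (\<Sum>i\<in>J \<union> K. ((if i \<in> J then c i else 0) + (if i \<in> K then d i else 0)) * \<phi> i x)"
      by (simp add: ring_distribs sum.distrib)
  qed
  show ?thesis
    unfolding eq lin_span_def mem_Collect_eq
    by (rule exI[of _ "J \<union> K"], rule exI[of _ "\<lambda>i. (if i \<in> J then c i else 0) + (if i \<in> K then d i else 0)"])
       (use J(1,2) K(1,2) in auto)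
qed

lemma lin_span_sum:
  assumes "\<And>j. j \<in> J \<Longrightarrow> f j \<in> lin_span I \<phi>"
  shows "(\<lambda>x. \<Sum>j\<in>J. f j x) \<in> lin_span I \<phi>"
  using assms by (induction J rule: infinite_finite_induct) (auto intro: lin_span_zero lin_span_add)

lemma lin_span_L2:
  assumes "\<And>i. i \<in> I \<Longrightarrow> \<phi> i \<in> L2 M" "f \<in> lin_span I \<phi>"
  shows "f \<in> L2 M"
  using assms unfolding lin_span_def by (auto intro!: L2_sum L2_scale)

lemma lin_span_closed_span:
  assumes "f \<in> lin_span I \<phi>" "f \<in> L2 M"
  shows "f \<in> closed_span M I \<phi>"
  unfolding closed_span_iff using assms by (auto intro!: bexI[of _ f] simp: L2_norm_def)

text \<open>An \<open>\<epsilon>/2\<close> argument. Because \<open>L2_norm\<close> is a seminorm,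
  the lemma also carries membership over to functions at distance 0, which is how almost-everywhere
  representatives are exchanged.\<close>

lemma closed_span_limit:
  assumes \<phi>: "\<And>i. i \<in> I \<Longrightarrow> \<phi> i \<in> L2 M" and "f \<in> L2 M"
    and "\<And>\<epsilon>. \<epsilon> > 0 \<Longrightarrow> \<exists>h\<in>closed_span M I \<phi>. L2_norm M (\<lambda>x. f x - h x) < \<epsilon>"
  shows "f \<in> closed_span M I \<phi>"
  unfolding closed_span_iff
proof (intro conjI allI impI)
  fix \<epsilon> :: real assume "\<epsilon> > 0"
  then obtain h where h: "h \<in> closed_span M I \<phi>" "L2_norm M (\<lambda>x. f x - h x) < \<epsilon> / 2"
    using assms(3)[of "\<epsilon> / 2"] by auto
  then obtain k where k: "k \<in> lin_span I \<phi>" "L2_norm M (\<lambda>x. h x - k x) < \<epsilon> / 2"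
    using \<open>\<epsilon> > 0\<close> unfolding closed_span_iff by (meson half_gt_zero)
  have "L2_norm M (\<lambda>x. f x - k x) < \<epsilon>"
    using L2_norm_triangle_diff[of f M h k] h k lin_span_L2[OF \<phi> k(1)] \<open>f \<in> L2 M\<close>
    by (auto simp: closed_span_iff)
  with k(1) show "\<exists>h\<in>lin_span I \<phi>. L2_norm M (\<lambda>x. f x - h x) < \<epsilon>" by blast
qed fact

lemma closed_span_add:
  assumes \<phi>: "\<And>i. i \<in> I \<Longrightarrow> \<phi> i \<in> L2 M" and f: "f \<in> closed_span M I \<phi>" and g: "g \<in> closed_span M I \<phi>"
  shows "(\<lambda>x. f x + g x) \<in> closed_span M I \<phi>"
  unfolding closed_span_iff
proof (intro conjI allI impI)
  have L: "f \<in> L2 M" "g \<in> L2 M" using f g by (auto simp: closed_span_iff)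
  then show "(\<lambda>x. f x + g x) \<in> L2 M" by (rule L2_add)
  fix \<epsilon> :: real assume "\<epsilon> > 0"
  then obtain h k where h: "h \<in> lin_span I \<phi>" "L2_norm M (\<lambda>x. f x - h x) < \<epsilon> / 2"
    and k: "k \<in> lin_span I \<phi>" "L2_norm M (\<lambda>x. g x - k x) < \<epsilon> / 2"
    using f g unfolding closed_span_iff by (meson half_gt_zero)
  have "L2_norm M (\<lambda>x. (f x - h x) + (g x - k x)) \<le> L2_norm M (\<lambda>x. f x - h x) + L2_norm M (\<lambda>x. g x - k x)"
    using lin_span_L2[OF \<phi> h(1)] lin_span_L2[OF \<phi> k(1)] by (intro L2_norm_triangle L2_diff L)
  then have "L2_norm M (\<lambda>x. f x + g x - (h x + k x)) < \<epsilon>"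
    using h k by (simp add: algebra_simps)
  then show "\<exists>h\<in>lin_span I \<phi>. L2_norm M (\<lambda>x. f x + g x - h x) < \<epsilon>"
    using lin_span_add[OF h(1) k(1)] by (intro bexI)
qed

lemma closed_span_scale:
  assumes f: "f \<in> closed_span M I \<phi>"
  shows "(\<lambda>x. a * f x) \<in> closed_span M I \<phi>"
  unfolding closed_span_iff
proof (intro conjI allI impI)
  show "(\<lambda>x. a * f x) \<in> L2 M" using f by (auto simp: closed_span_iff intro: L2_scale)
  fix \<epsilon> :: real assume "\<epsilon> > 0"
  then have "\<epsilon> / (cmod a + 1) > 0" by (simp add: add_nonneg_pos)
  then obtain h where h: "h \<in> lin_span I \<phi>" "L2_norm M (\<lambda>x. f x - h x) < \<epsilon> / (cmod a + 1)"
    using f unfolding closed_span_iff by blast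
  have "L2_norm M (\<lambda>x. a * f x - a * h x) = cmod a * L2_norm M (\<lambda>x. f x - h x)"
    unfolding right_diff_distrib[symmetric] by (rule L2_norm_scale)
  also have "\<dots> \<le> (cmod a + 1) * L2_norm M (\<lambda>x. f x - h x)"
    by (intro mult_right_mono) auto
  also have "\<dots> < \<epsilon>" using h(2) by (simp add: field_simps add_pos_nonneg)
  finally show "\<exists>h\<in>lin_span I \<phi>. L2_norm M (\<lambda>x. a * f x - h x) < \<epsilon>"
    using lin_span_scale[OF h(1)] by (intro bexI)
qed

lemma closed_span_diff:
  assumes \<phi>: "\<And>i. i \<in> I \<Longrightarrow> \<phi> i \<in> L2 M" and f: "f \<in> closed_span M I \<phi>" and g: "g \<in> closed_span M I \<phi>"
  shows "(\<lambda>x. f x - g x) \<in> closed_span M I \<phi>"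
  using closed_span_add[OF \<phi> f closed_span_scale[OF g, of "-1"]] by simp

lemma closed_span_sum:
  assumes \<phi>: "\<And>i. i \<in> I \<Longrightarrow> \<phi> i \<in> L2 M" and "\<And>j. j \<in> J \<Longrightarrow> f j \<in> closed_span M I \<phi>"
  shows "(\<lambda>x. \<Sum>j\<in>J. f j x) \<in> closed_span M I \<phi>"
  using assms(2)
  by (induction J rule: infinite_finite_induct)
     (auto intro!: lin_span_closed_span[OF lin_span_zero L2_zero] closed_span_add[OF \<phi>])

lemma closed_span_seq_limit:
  assumes \<phi>: "\<And>i. i \<in> I \<Longrightarrow> \<phi> i \<in> L2 M" and "f \<in> L2 M" and "\<And>n. s n \<in> closed_span M I \<phi>"
    and "(\<lambda>n. L2_norm M (\<lambda>x. s n x - f x)) \<longlonglongrightarrow> 0"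
  shows "f \<in> closed_span M I \<phi>"
proof (rule closed_span_limit[OF \<phi> \<open>f \<in> L2 M\<close>])
  fix \<epsilon> :: real assume "\<epsilon> > 0"
  with assms(4) have "\<forall>\<^sub>F n in sequentially. L2_norm M (\<lambda>x. s n x - f x) < \<epsilon>"
    by (rule order_tendstoD(2))
  then obtain n where "L2_norm M (\<lambda>x. s n x - f x) < \<epsilon>"
    by (auto dest: eventually_happens)
  with assms(3) show "\<exists>h\<in>closed_span M I \<phi>. L2_norm M (\<lambda>x. f x - h x) < \<epsilon>"
    by (auto simp: L2_norm_minus_commute[of M f])
qed

subsection \<open>Characters of the torus\<close>

lemma borel_measurable_cis [measurable]: "cis \<in> borel_measurable borel"
  by (intro borel_measurable_continuous_onI continuous_intros)

text \<open>\<open>Arg2pi\<close> jumps across the non-negative reals but is 0 on them, so it is a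
  function continuous on an open set and extended by zero. It serves to recover a point of
  \<open>Q\<close> from its image on the torus.\<close>

lemma borel_measurable_Arg2pi [measurable]: "Arg2pi \<in> borel_measurable borel"
proof -
  have "closed (\<real>\<^sub>\<ge>\<^sub>0 :: complex set)" by (rule closed_nonneg_Reals_complex)
  then have "(\<lambda>z. indicator (- \<real>\<^sub>\<ge>\<^sub>0) z *\<^sub>R Arg2pi z) \<in> borel_measurable borel"
    by (intro borel_measurable_continuous_on_indicator continuous_at_imp_continuous_on)
       (auto intro: continuous_at_Arg2pi)
  also have "(\<lambda>z. indicator (- \<real>\<^sub>\<ge>\<^sub>0) z *\<^sub>R Arg2pi z) = Arg2pi"
    by (auto simp: indicator_def Arg2pi_eq_0 complex_nonneg_Reals_iff complex_is_Real_iff fun_eq_iff)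
  finally show ?thesis .
qed

lemma Arg2pi_cis:
  assumes "0 \<le> t" "t < 2 * pi"
  shows "Arg2pi (cis t) = t"
  using assms by (intro Arg2pi_unique[of 1]) (auto simp: cis_conv_exp)

lemma Q_borel [measurable]: "Q \<in> sets borel"
  unfolding Q_def by (simp add: borel_prod[symmetric])

lemma space_lborel_Q: "space lborel_Q = Q"
  by (simp add: space_restrict_space)

lemma emeasure_lborel_Q: "emeasure lborel_Q Q = 1"
proof -
  have "emeasure lborel_Q Q = emeasure (lborel \<Otimes>\<^sub>M lborel) Q"
    by (simp add: emeasure_restrict_space lborel_prod)
  also have "\<dots> = 1"
    unfolding Q_def by (subst lborel.emeasure_pair_measure_Times) auto
  finally show ?thesis .
qed

lemma finite_measure_lborel_Q: "finite_measure lborel_Q"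
  by (rule finite_measureI) (simp only: space_lborel_Q emeasure_lborel_Q, simp)

text \<open>
  With the sign in front of \<open>a\<close>, the Zak transform maps the time-frequency shift by \<open>(a, b)\<close> to
  multiplication by \<open>torus_char (a, b)\<close>.
\<close>

definition torus_char :: "real \<times> real \<Rightarrow> real \<times> real \<Rightarrow> complex" where
  "torus_char = (\<lambda>(a, b) (x, \<xi>). cis (2 * pi * (b * x - a * \<xi>)))"

lemma torus_char_measurable [measurable]: "torus_char n \<in> borel_measurable borel"
  by (cases n) (simp add: torus_char_def borel_prod[symmetric] split_beta)

lemma torus_char_measurable_Q [measurable]: "torus_char n \<in> borel_measurable lborel_Q"
  by (intro measurable_restrict_space1) simp

lemma cmod_torus_char [simp]: "cmod (torus_char n p) = 1"
  by (simp add: torus_char_def split_beta)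

lemma torus_char_add: "torus_char (m + n) p = torus_char m p * torus_char n p"
  by (simp add: torus_char_def split_beta cis_mult algebra_simps)

lemma torus_char_0 [simp]: "torus_char 0 p = 1"
  by (simp add: torus_char_def split_beta)

lemma cnj_torus_char: "cnj (torus_char n p) = torus_char (- n) p"
  by (simp add: torus_char_def split_beta cis_cnj algebra_simps)

lemma bounded_L2:
  assumes "finite_measure M" "f \<in> borel_measurable M" "\<And>x. x \<in> space M \<Longrightarrow> cmod (f x) \<le> B"
  shows "f \<in> L2 M"
proof (rule L2_bound)
  show "(\<lambda>x. complex_of_real B) \<in> L2 M"
    using finite_measure.integrable_const[OF assms(1)] by (intro L2_I) auto
  show "AE x in M. cmod (f x) \<le> cmod (complex_of_real B)"
    using assms(3) by (auto intro!: AE_I2 order_trans[OF _ abs_ge_self])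
qed fact

lemma torus_char_L2: "torus_char n \<in> L2 lborel_Q"
  by (rule bounded_L2[OF finite_measure_lborel_Q, of _ 1]) auto

lemma integral_lborel_Q:
  fixes f :: "real \<times> real \<Rightarrow> 'a::{banach, second_countable_topology}"
  assumes "integrable lborel_Q f"
  shows "(\<integral>p. f p \<partial>lborel_Q) = (LINT x:{0..<1}|lborel. (LINT \<xi>:{0..<1}|lborel. f (x, \<xi>)))"
proof -
  have "integrable (lborel \<Otimes>\<^sub>M lborel) (\<lambda>p. indicator Q p *\<^sub>R f p)"
    using assms by (simp add: integrable_restrict_space lborel_prod)
  then have "(\<integral>x. (\<integral>\<xi>. indicator Q (x, \<xi>) *\<^sub>R f (x, \<xi>) \<partial>lborel) \<partial>lborel)
      = integral\<^sup>L (lborel \<Otimes>\<^sub>M lborel) (\<lambda>p. indicator Q p *\<^sub>R f p)"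
    by (rule lborel_pair.integral_fst')
  also have "\<dots> = (\<integral>p. f p \<partial>lborel_Q)"
    by (simp add: integral_restrict_space lborel_prod)
  also have "(\<integral>x. (\<integral>\<xi>. indicator Q (x, \<xi>) *\<^sub>R f (x, \<xi>) \<partial>lborel) \<partial>lborel)
      = (LINT x:{0..<1}|lborel. (LINT \<xi>:{0..<1}|lborel. f (x, \<xi>)))"
    unfolding set_lebesgue_integral_def Q_def
    by (simp add: indicator_times scaleR_scaleR[symmetric] del: scaleR_scaleR)
  finally show ?thesis by simp
qed

lemma integral_cis_period:
  assumes "k \<in> \<int>"
  shows "(LINT \<xi>:{0..<1}|lborel. cis (2 * pi * (k * \<xi>))) = (if k = 0 then 1 else 0)"
proof (cases "k = 0")
  case True
  then show ?thesis by (simp add: set_lebesgue_integral_def)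
next
  case False
  \<comment> \<open>An antiderivative; integrality of \<open>k\<close> gives it equal values at both
    endpoints.\<close>
  define F where "F \<xi> = cis (2 * pi * (k * \<xi>)) / (\<i> * of_real (2 * pi * k))" for \<xi> :: real
  have "has_bochner_integral lborel (\<lambda>\<xi>. indicator {0..1} \<xi> *\<^sub>R cis (2 * pi * (k * \<xi>))) (F 1 - F 0)"
  proof (rule has_bochner_integral_FTC_Icc)
    fix \<xi> :: real
    show "(F has_vector_derivative cis (2 * pi * (k * \<xi>))) (at \<xi> within {0..1})"
      unfolding F_def has_vector_derivative_def
      by (auto intro!: derivative_eq_intros simp: False fun_eq_iff field_simps scaleR_conv_of_real)
  qed (auto intro!: continuous_intros)
  moreover have "F 1 - F 0 = 0"
    using assms by (auto elim!: Ints_cases simp: F_def cis_multiple_2pi)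
  ultimately have "(LINT \<xi>:{0..1}|lborel. cis (2 * pi * (k * \<xi>))) = 0"
    by (simp add: set_lebesgue_integral_def has_bochner_integral_integral_eq)
  also have "(LINT \<xi>:{0..1}|lborel. cis (2 * pi * (k * \<xi>))) = (LINT \<xi>:{0..<1}|lborel. cis (2 * pi * (k * \<xi>)))"
    unfolding set_lebesgue_integral_def
  proof (rule integral_cong_AE)
    show "AE \<xi> in lborel. indicator {0..1} \<xi> *\<^sub>R cis (2 * pi * (k * \<xi>))
        = indicator {0..<1} \<xi> *\<^sub>R cis (2 * pi * (k * \<xi>))"
      using AE_lborel_singleton[of "1::real"] by eventually_elim (auto simp: indicator_def)
  qed measurable
  finally show ?thesis using False by simp
qed

lemma integral_torus_char:
  assumes "n \<in> \<int> \<times> \<int>"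
  shows "(\<integral>p. torus_char n p \<partial>lborel_Q) = (if n = 0 then 1 else 0)"
proof -
  obtain a b where n: "n = (a, b)" by (cases n)
  with assms have ab: "- a \<in> \<int>" "b \<in> \<int>" by auto
  interpret finite_measure lborel_Q by (rule finite_measure_lborel_Q)
  have "integrable lborel_Q (torus_char n)"
    by (rule integrable_const_bound[of _ 1]) auto
  then have "(\<integral>p. torus_char n p \<partial>lborel_Q)
      = (LINT x:{0..<1}|lborel. (LINT \<xi>:{0..<1}|lborel. torus_char n (x, \<xi>)))"
    by (rule integral_lborel_Q)
  also have "\<dots> = (LINT x:{0..<1}|lborel. cis (2 * pi * (b * x)) * (LINT \<xi>:{0..<1}|lborel. cis (2 * pi * (- a * \<xi>))))"
    unfolding set_integral_mult_right[symmetric] by (simp add: n torus_char_def cis_mult algebra_simps)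
  also have "\<dots> = (if n = 0 then 1 else 0)"
    unfolding integral_cis_period[OF ab(1)] set_integral_mult_left integral_cis_period[OF ab(2)]
    by (simp add: n prod_eq_iff)
  finally show ?thesis .
qed

lemma torus_char_orthonormal:
  assumes "m \<in> \<int> \<times> \<int>" "n \<in> \<int> \<times> \<int>"
  shows "L2_inner lborel_Q (torus_char m) (torus_char n) = (if m = n then 1 else 0)"
proof -
  have "m - n \<in> \<int> \<times> \<int>" using assms by (auto simp: mem_Times_iff)
  from integral_torus_char[OF this] show ?thesis
    by (simp add: L2_inner_def cnj_torus_char torus_char_add[symmetric])
qed

subsection \<open>Density of trigonometric polynomials\<close>

abbreviation trig_polys :: "(real \<times> real \<Rightarrow> complex) set" where
  "trig_polys \<equiv> lin_span (\<int> \<times> \<int>) torus_char"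

lemma trig_polys_mult:
  assumes "f \<in> trig_polys" "g \<in> trig_polys"
  shows "(\<lambda>p. f p * g p) \<in> trig_polys"
proof -
  from assms obtain J c K d where J: "finite J" "J \<subseteq> \<int> \<times> \<int>" "f = (\<lambda>p. \<Sum>m\<in>J. c m * torus_char m p)"
    and K: "finite K" "K \<subseteq> \<int> \<times> \<int>" "g = (\<lambda>p. \<Sum>n\<in>K. d n * torus_char n p)"
    unfolding lin_span_def by blast
  have "(\<lambda>p. f p * g p) = (\<lambda>p. \<Sum>m\<in>J. \<Sum>n\<in>K. c m * d n * torus_char (m + n) p)"
    unfolding J K sum_product by (simp add: torus_char_add mult_ac)
  also have "\<dots> \<in> trig_polys"
  proof (intro lin_span_sum lin_span_scale lin_span_base)
    show "m + n \<in> \<int> \<times> \<int>" if "m \<in> J" "n \<in> K" for m n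
      using that J(2) K(2) by (metis Ints_add fst_add mem_Times_iff snd_add subsetD)
  qed
  finally show ?thesis .
qed

text \<open>The torus as a compact product of two circles in the complex plane squared. Opposite
  sides of the square are identified there, as characters with integer indices demand, and
  Stone-Weierstrass applies.\<close>

definition torus_point :: "real \<times> real \<Rightarrow> complex \<times> complex" where
  "torus_point = (\<lambda>(x, \<xi>). (cis (2 * pi * x), cis (2 * pi * \<xi>)))"

lemma torus_point_measurable [measurable]: "torus_point \<in> borel \<rightarrow>\<^sub>M borel"
  unfolding torus_point_def borel_prod[symmetric] by measurable

text \<open>The real coordinates of a torus point are sines and cosines, hence combinations of two
  conjugate characters each, and products of characters with integer indices are again such
  characters.\<close>

lemma polynomial_torus_point:
  assumes "real_polynomial_function P"
  shows "(\<lambda>p. of_real (P (torus_point p))) \<in> trig_polys"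
  using assms
proof (induction rule: real_polynomial_function.induct)
  case (linear f)
  interpret bounded_linear f by fact
  have f_eq: "f (z, w) = Re z * f (1, 0) + Im z * f (\<i>, 0) + Re w * f (0, 1) + Im w * f (0, \<i>)" for z w
  proof -
    have "(z, w) = Re z *\<^sub>R (1, 0) + Im z *\<^sub>R (\<i>, 0) + Re w *\<^sub>R (0, 1) + Im w *\<^sub>R (0, \<i>)"
      by (simp add: complex_eq_iff)
    then show ?thesis by (simp only: add scaleR) simp
  qed
  have c: "complex_of_real (cos t) = (cis t + cis (- t)) / 2"
    and s: "complex_of_real (sin t) = - \<i> / 2 * (cis t - cis (- t))" for t
    by (auto simp: complex_eq_iff)
  \<comment> \<open>Euler's formulas regrouped into sums and scalar multiples, with differences
    written as \<open>+ (-1) *\<close>, the shape to which the closure rules of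
    \<open>lin_span\<close> apply.\<close>
  have gen: "(u + u') / 2 * \<alpha> + - \<i> / 2 * (u - u') * \<beta> + (v + v') / 2 * \<gamma> + - \<i> / 2 * (v - v') * \<delta>
      = \<alpha> / 2 * (u + u') + - \<i> * \<beta> / 2 * (u + (-1) * u') + (\<gamma> / 2 * (v + v') + - \<i> * \<delta> / 2 * (v + (-1) * v'))"
    for u u' v v' \<alpha> \<beta> \<gamma> \<delta> :: complex
    by (simp add: field_simps)
  let ?E = torus_char
  have "(\<lambda>p. of_real (f (torus_point p))) = (\<lambda>p.
      of_real (f (1, 0)) / 2 * (?E (0, 1) p + ?E (0, -1) p)
      + - \<i> * of_real (f (\<i>, 0)) / 2 * (?E (0, 1) p + (-1) * ?E (0, -1) p)
      + (of_real (f (0, 1)) / 2 * (?E (-1, 0) p + ?E (1, 0) p)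
      + - \<i> * of_real (f (0, \<i>)) / 2 * (?E (-1, 0) p + (-1) * ?E (1, 0) p)))"
  proof
    fix p :: "real \<times> real"
    obtain x \<xi> where p: "p = (x, \<xi>)" by (cases p)
    have "?E (0, 1) p = cis (2 * pi * x)" "?E (0, -1) p = cis (- (2 * pi * x))"
      "?E (-1, 0) p = cis (2 * pi * \<xi>)" "?E (1, 0) p = cis (- (2 * pi * \<xi>))"
      by (simp_all add: torus_char_def p)
    note E = this
    have "complex_of_real (f (torus_point p))
        = of_real (cos (2 * pi * x)) * of_real (f (1, 0)) + of_real (sin (2 * pi * x)) * of_real (f (\<i>, 0))
        + of_real (cos (2 * pi * \<xi>)) * of_real (f (0, 1)) + of_real (sin (2 * pi * \<xi>)) * of_real (f (0, \<i>))"
      unfolding p torus_point_def prod.case by (subst f_eq) simp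
    also have "\<dots> = of_real (f (1, 0)) / 2 * (?E (0, 1) p + ?E (0, -1) p)
      + - \<i> * of_real (f (\<i>, 0)) / 2 * (?E (0, 1) p + (-1) * ?E (0, -1) p)
      + (of_real (f (0, 1)) / 2 * (?E (-1, 0) p + ?E (1, 0) p)
      + - \<i> * of_real (f (0, \<i>)) / 2 * (?E (-1, 0) p + (-1) * ?E (1, 0) p))"
      unfolding E c s by (rule gen)
    finally show "complex_of_real (f (torus_point p)) = \<dots>" .
  qed
  also have "\<dots> \<in> trig_polys"
    by (intro lin_span_add lin_span_scale lin_span_base) auto
  finally show ?case .
next
  case (const c)
  show ?case
    using lin_span_scale[OF lin_span_base[of 0 "\<int> \<times> \<int>" torus_char], of "of_real c"]
    by (simp add: mem_Times_iff)
next
  case (add f g)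
  then show ?case using lin_span_add by fastforce
next
  case (mult f g)
  then show ?case using trig_polys_mult by fastforce
qed

section \<open>Density for an arbitrary finite measure on the square\<close>

context
  fixes \<mu> :: "(real \<times> real) measure"
  assumes fin: "finite_measure \<mu>" and sets: "sets \<mu> = sets lborel_Q"
begin

lemma space_weight: "space \<mu> = Q"
  using sets_eq_imp_space_eq[OF sets] by (simp only: space_lborel_Q)

lemma weight_measurable: "f \<in> borel_measurable borel \<Longrightarrow> f \<in> borel_measurable \<mu>"
  by (subst measurable_cong_sets[OF sets refl]) (intro measurable_restrict_space1, simp)

lemma torus_char_L2_weight: "torus_char n \<in> L2 \<mu>"
  by (rule bounded_L2[OF fin, of _ 1]) (auto intro: weight_measurable)

text \<open>Stone-Weierstrass approximates uniformly on the product of the circles. As the measure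
  is finite, a uniform error \<open>\<delta>\<close> costs at most \<open>\<delta>\<close> times the
  norm of the constant 1.\<close>

lemma continuous_in_closed_span:
  assumes \<phi>: "continuous_on UNIV \<phi>"
  shows "(\<lambda>p. complex_of_real (\<phi> (torus_point p))) \<in> closed_span \<mu> (\<int> \<times> \<int>) torus_char"
  unfolding closed_span_iff
proof (intro conjI allI impI)
  define K where "K = (sphere 0 1 :: complex set) \<times> (sphere 0 1 :: complex set)"
  have "compact K" unfolding K_def by (intro compact_Times compact_sphere)
  have in_K: "torus_point p \<in> K" for p by (simp add: K_def torus_point_def split_beta)
  have \<phi>_K: "continuous_on K \<phi>" using \<phi> continuous_on_subset by blast
  have [measurable]: "\<phi> \<in> borel_measurable borel" using \<phi> by (rule borel_measurable_continuous_onI)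
  obtain B where "\<And>z. z \<in> K \<Longrightarrow> \<bar>\<phi> z\<bar> \<le> B"
    using compact_imp_bounded[OF compact_continuous_image[OF \<phi>_K \<open>compact K\<close>]]
    by (auto simp: bounded_real)
  then show "(\<lambda>p. complex_of_real (\<phi> (torus_point p))) \<in> L2 \<mu>"
    using in_K by (intro bounded_L2[OF fin, of _ B] weight_measurable) auto
  fix \<epsilon> :: real assume "\<epsilon> > 0"
  define m where "m = L2_norm \<mu> (\<lambda>p. 1)"
  define \<delta> where "\<delta> = \<epsilon> / (m + 1)"
  have "m \<ge> 0" by (simp add: m_def)
  with \<open>\<epsilon> > 0\<close> have "\<delta> > 0" by (simp add: \<delta>_def)
  obtain P where P: "real_polynomial_function P" "\<And>z. z \<in> K \<Longrightarrow> \<bar>\<phi> z - P z\<bar> < \<delta>"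
    using Stone_Weierstrass_real_polynomial_function[OF \<open>compact K\<close> \<phi>_K \<open>\<delta> > 0\<close>] by blast
  have P_trig: "(\<lambda>p. complex_of_real (P (torus_point p))) \<in> trig_polys"
    by (rule polynomial_torus_point) fact
  have "L2_norm \<mu> (\<lambda>p. complex_of_real (\<phi> (torus_point p)) - complex_of_real (P (torus_point p)))
      \<le> L2_norm \<mu> (\<lambda>p. complex_of_real \<delta> * 1)"
  proof (rule L2_norm_mono)
    show "(\<lambda>p. complex_of_real (\<phi> (torus_point p)) - complex_of_real (P (torus_point p))) \<in> borel_measurable \<mu>"
      by (intro borel_measurable_diff weight_measurable L2_measurable[OF lin_span_L2[OF torus_char_L2_weight P_trig]])
         measurable
    show "(\<lambda>p. complex_of_real \<delta> * 1) \<in> L2 \<mu>"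
      by (rule bounded_L2[OF fin, of _ \<delta>]) (use \<open>\<delta> > 0\<close> in auto)
    show "AE p in \<mu>. cmod (complex_of_real (\<phi> (torus_point p)) - complex_of_real (P (torus_point p)))
        \<le> cmod (complex_of_real \<delta> * 1)"
      using P(2)[OF in_K] \<open>\<delta> > 0\<close>
      by (intro AE_I2) (simp add: of_real_diff[symmetric] less_imp_le del: of_real_diff)
  qed
  also have "\<dots> = \<delta> * m" unfolding L2_norm_scale m_def using \<open>\<delta> > 0\<close> by simp
  also have "\<dots> < \<epsilon>" using \<open>m \<ge> 0\<close> \<open>\<epsilon> > 0\<close> by (simp add: \<delta>_def field_simps)
  finally show "\<exists>h\<in>trig_polys. L2_norm \<mu> (\<lambda>p. complex_of_real (\<phi> (torus_point p)) - h p) < \<epsilon>"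
    using P_trig by (rule bexI)
qed

text \<open>The indicator of an open set is the pointwise limit of the continuous functions
  \<open>min 1 (k * distance to the complement)\<close>, all bounded by 1.\<close>

lemma open_in_closed_span:
  assumes "open U"
  shows "(\<lambda>p. indicator U (torus_point p)) \<in> closed_span \<mu> (\<int> \<times> \<int>) torus_char"
\<comment> \<open>The distance to the empty set is 0 by convention, so the approximating functions
  would vanish for \<open>U = UNIV\<close>; there the indicator is the trivial character.\<close>
proof (cases "U = UNIV")
  case True
  have "(0 :: real \<times> real) \<in> \<int> \<times> \<int>" by (simp add: mem_Times_iff)
  then have "torus_char 0 \<in> closed_span \<mu> (\<int> \<times> \<int>) torus_char"
    by (intro lin_span_closed_span lin_span_base torus_char_L2_weight)
  moreover have "torus_char 0 = (\<lambda>p. indicator U (torus_point p))"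
    using True by (simp add: fun_eq_iff)
  ultimately show ?thesis by simp
next
  case False
  define \<phi> where "\<phi> k z = min 1 (real k * infdist z (- U))" for k z
  have cont: "continuous_on UNIV (\<phi> k)" for k
    unfolding \<phi>_def by (intro continuous_intros)
  have ind: "(\<lambda>k. \<phi> k z) \<longlonglongrightarrow> indicator U z" for z
  proof (cases "z \<in> U")
    case True
    have "infdist z (- U) \<noteq> 0"
      using in_closed_iff_infdist_zero[of "- U" z] \<open>open U\<close> False True by auto
    then have pos: "infdist z (- U) > 0" using infdist_nonneg[of z "- U"] by linarith
    then obtain N where N: "1 \<le> real N * infdist z (- U)"
      using reals_Archimedean3[OF pos] less_imp_le by blast
    have "\<phi> k z = indicator U z" if "k \<ge> N" for k
      using order_trans[OF N mult_right_mono[of "real N" "real k" "infdist z (- U)"]] that pos True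
      by (simp add: \<phi>_def)
    then show ?thesis by (intro tendsto_eventually eventually_sequentiallyI)
  qed (simp add: \<phi>_def infdist_zero)
  have bd: "\<bar>\<phi> k z\<bar> \<le> 1" for k z unfolding \<phi>_def by (simp add: infdist_nonneg)
  have [measurable]: "\<phi> k \<in> borel_measurable borel" for k
    using cont by (rule borel_measurable_continuous_onI)
  have [measurable]: "U \<in> sets borel" using assms by simp
  note dom = L2_dominated_convergence[of "\<lambda>k p. complex_of_real (\<phi> k (torus_point p))" \<mu>
      "\<lambda>p. indicator U (torus_point p)" "\<lambda>p. 1"]
  have one: "(\<lambda>p. 1) \<in> L2 \<mu>" by (rule bounded_L2[OF fin, of _ 1]) auto
  have lim: "AE p in \<mu>. (\<lambda>k. complex_of_real (\<phi> k (torus_point p))) \<longlonglongrightarrow> indicator U (torus_point p)"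
  proof (rule AE_I2)
    fix p
    have "complex_of_real (indicator U z) = indicator U z" for z by (simp add: indicator_def)
    with tendsto_of_real[OF ind, of "torus_point p", where ?'a = complex]
    show "(\<lambda>k. complex_of_real (\<phi> k (torus_point p))) \<longlonglongrightarrow> indicator U (torus_point p)" by simp
  qed
  show ?thesis
  proof (rule closed_span_seq_limit[OF torus_char_L2_weight])
    show "(\<lambda>p. indicator U (torus_point p)) \<in> L2 \<mu>"
      by (rule bounded_L2[OF fin, of _ 1]) (auto intro: weight_measurable simp: indicator_def)
    show "(\<lambda>p. complex_of_real (\<phi> k (torus_point p))) \<in> closed_span \<mu> (\<int> \<times> \<int>) torus_char" for k
      by (rule continuous_in_closed_span[OF cont])
    show "(\<lambda>k. L2_norm \<mu> (\<lambda>p. complex_of_real (\<phi> k (torus_point p)) - indicator U (torus_point p))) \<longlonglongrightarrow> 0"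
      by (rule dom(2)) (use one lim bd in \<open>auto intro: weight_measurable\<close>)
  qed
qed

text \<open>Dynkin's argument: the open sets are stable under intersection and generate the Borel
  sets, while the sets with the stated property admit complements and disjoint countable unions, the
  latter by dominated convergence.\<close>

lemma borel_in_closed_span:
  assumes "A \<in> sets borel"
  shows "(\<lambda>p. indicator A (torus_point p)) \<in> closed_span \<mu> (\<int> \<times> \<int>) torus_char"
proof -
  let ?C = "closed_span \<mu> (\<int> \<times> \<int>) torus_char"
  have one: "(\<lambda>p. 1) \<in> ?C" using open_in_closed_span[of UNIV] by simp
  have "Int_stable (Collect (open :: (complex \<times> complex) set \<Rightarrow> bool))" by (auto simp: Int_stable_def)
  moreover have "Collect open \<subseteq> Pow (UNIV :: (complex \<times> complex) set)" by simp
  moreover have "A \<in> sigma_sets UNIV (Collect open)" using assms by (simp add: borel_def)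
  ultimately show ?thesis
  proof (induction rule: sigma_sets_induct_disjoint)
    case (basic A)
    then show ?case by (intro open_in_closed_span) simp
  next
    case empty
    show ?case using open_in_closed_span[of "{}"] by simp
  next
    case (compl A)
    have "(\<lambda>p. indicator (UNIV - A) (torus_point p) :: complex) = (\<lambda>p. 1 - indicator A (torus_point p))"
      by (auto simp: indicator_def)
    with closed_span_diff[OF torus_char_L2_weight one compl(2)] show ?case by simp
  next
    case (union A)
    have A [measurable]: "A i \<in> sets borel" for i using union(2) by (auto simp: borel_def)
    have sum_eq: "(\<Sum>i<k. indicator (A i) z) = (indicator (\<Union>i<k. A i) z :: complex)" for k z
      using union(1) by (subst indicator_UN_disjoint) (auto simp: disjoint_family_on_def)
    have "(\<lambda>k. (indicator (\<Union>i<k. A i) z :: complex)) \<longlonglongrightarrow> indicator (\<Union>i. A i) z" for z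
      by (rule LIMSEQ_indicator_UN)
    then have lim: "(\<lambda>k. \<Sum>i<k. (indicator (A i) (torus_point p) :: complex)) \<longlonglongrightarrow> indicator (\<Union>i. A i) (torus_point p)" for p
      unfolding sum_eq .
    have one': "(\<lambda>p. 1) \<in> L2 \<mu>" by (rule bounded_L2[OF fin, of _ 1]) auto
    show ?case
    proof (rule closed_span_seq_limit[OF torus_char_L2_weight])
      show "(\<lambda>p. indicator (\<Union>i. A i) (torus_point p)) \<in> L2 \<mu>"
        by (rule bounded_L2[OF fin, of _ 1]) (auto intro: weight_measurable simp: indicator_def)
      show "(\<lambda>p. \<Sum>i<k. indicator (A i) (torus_point p)) \<in> ?C" for k
        by (intro closed_span_sum[OF torus_char_L2_weight] union(3))
      show "(\<lambda>k. L2_norm \<mu> (\<lambda>p. (\<Sum>i<k. indicator (A i) (torus_point p)) - indicator (\<Union>i. A i) (torus_point p))) \<longlonglongrightarrow> 0"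
      proof (rule L2_dominated_convergence(2)[OF _ _ one'])
        show "(\<lambda>p. \<Sum>i<k. indicator (A i) (torus_point p) :: complex) \<in> borel_measurable \<mu>" for k
        proof (rule weight_measurable)
          have "(\<Union>i<k. A i) \<in> sets borel" using A by auto
          then show "(\<lambda>p. \<Sum>i<k. indicator (A i) (torus_point p) :: complex) \<in> borel_measurable borel"
            unfolding sum_eq by measurable
        qed
        show "(\<lambda>p. indicator (\<Union>i. A i) (torus_point p) :: complex) \<in> borel_measurable \<mu>"
        proof (rule weight_measurable)
          have "(\<Union>i. A i) \<in> sets borel" using A by auto
          then show "(\<lambda>p. indicator (\<Union>i. A i) (torus_point p) :: complex) \<in> borel_measurable borel"
            by measurable
        qed
        show "AE p in \<mu>. cmod (\<Sum>i<k. indicator (A i) (torus_point p)) \<le> cmod 1" for k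
          unfolding sum_eq by (auto simp: indicator_def)
      qed (use lim in auto)
    qed
  qed
qed

text \<open>\<open>torus_point\<close> is injective on \<open>Q\<close> with the Borel left inverse
  \<open>S\<close>. A measurable subset \<open>A\<close> of the square is thus the pullback of a
  Borel set of the torus, namely of the preimage of \<open>A\<close> under \<open>S\<close>.\<close>

lemma indicator_in_closed_span:
  assumes "A \<in> sets \<mu>"
  shows "indicator A \<in> closed_span \<mu> (\<int> \<times> \<int>) torus_char"
proof -
  define S where "S = (\<lambda>(z, w). (Arg2pi z / (2 * pi), Arg2pi w / (2 * pi)))"
  have [measurable]: "S \<in> borel \<rightarrow>\<^sub>M borel" unfolding S_def borel_prod[symmetric] by measurable
  have A: "A \<in> sets borel" "A \<subseteq> Q"
    using assms by (auto simp: sets sets_restrict_space_iff)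
  have S: "S (torus_point p) = p" if "p \<in> Q" for p
    using that by (auto simp: Q_def S_def torus_point_def Arg2pi_cis)
  have ind: "indicator (S -` A) (torus_point p) = (indicator A p :: complex)" if "p \<in> space \<mu>" for p
    using S[of p] that by (auto simp: space_weight indicator_def)
  have "S -` A \<in> sets borel" using measurable_sets[of S borel borel A] A by simp
  from borel_in_closed_span[OF this]
  have "(\<lambda>p. indicator (S -` A) (torus_point p)) \<in> closed_span \<mu> (\<int> \<times> \<int>) torus_char" .
  moreover have "L2_norm \<mu> (\<lambda>p. indicator A p - indicator (S -` A) (torus_point p)) = 0"
    using ind by (subst L2_norm_cong[of _ _ "\<lambda>_. 0"]) (auto simp: L2_norm_def)
  ultimately show ?thesis
    using assms
    by (intro closed_span_limit[OF torus_char_L2_weight] bounded_L2[OF fin, of _ 1])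
       (auto simp: indicator_def intro!: bexI[of _ "\<lambda>p. indicator (S -` A) (torus_point p)"])
qed

theorem trig_polys_dense:
  assumes f: "f \<in> L2 \<mu>"
  shows "f \<in> closed_span \<mu> (\<int> \<times> \<int>) torus_char"
proof -
  have [measurable]: "f \<in> borel_measurable \<mu>" using f by auto
  obtain s where s: "\<And>i. simple_function \<mu> (s i)"
    and lim: "\<And>p. p \<in> space \<mu> \<Longrightarrow> (\<lambda>i. s i p) \<longlonglongrightarrow> f p"
    and bd: "\<And>i p. p \<in> space \<mu> \<Longrightarrow> cmod (s i p) \<le> 2 * cmod (f p)"
  proof -
    from borel_measurable_implies_sequence_metric[of f \<mu> 0]
    obtain s where "\<forall>i. simple_function \<mu> (s i)" "\<forall>p\<in>space \<mu>. (\<lambda>i. s i p) \<longlonglongrightarrow> f p"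
      "\<forall>i. \<forall>p\<in>space \<mu>. dist (s i p) 0 \<le> 2 * dist (f p) 0" by auto
    then show thesis by (intro that[of s]) auto
  qed
  have [measurable]: "s i \<in> borel_measurable \<mu>" for i using s by (rule borel_measurable_simple_function)
  have f2: "(\<lambda>p. 2 * f p) \<in> L2 \<mu>" using f by (rule L2_scale)
  have s_L2: "s i \<in> L2 \<mu>" for i
    by (rule L2_bound[OF _ f2]) (use bd in \<open>auto simp: norm_mult\<close>)
  show ?thesis
  proof (rule closed_span_seq_limit[OF torus_char_L2_weight f])
    fix i
    let ?t = "\<lambda>p. \<Sum>y\<in>s i ` space \<mu>. y * indicator (s i -` {y} \<inter> space \<mu>) p"
    have t: "?t \<in> closed_span \<mu> (\<int> \<times> \<int>) torus_char"
      using s[of i] by (intro closed_span_sum[OF torus_char_L2_weight] closed_span_scale indicator_in_closed_span)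
        (auto dest: simple_functionD)
    have st: "s i p = ?t p" if "p \<in> space \<mu>" for p
    proof -
      have "?t p = (\<Sum>y\<in>s i ` space \<mu>. if s i p = y then y else 0)"
        using that by (intro sum.cong) (auto simp: indicator_def)
      also have "\<dots> = s i p" using that simple_functionD(1)[OF s[of i]] by simp
      finally show ?thesis by simp
    qed
    have "s i p - ?t p = 0" if "p \<in> space \<mu>" for p
      using st[OF that] by (rule right_minus_eq[THEN iffD2])
    then have "L2_norm \<mu> (\<lambda>p. s i p - ?t p) = L2_norm \<mu> (\<lambda>p. 0)"
      by (intro L2_norm_cong arg_cong[of _ _ cmod])
    then have "L2_norm \<mu> (\<lambda>p. s i p - ?t p) = 0"
      by (simp only: L2_norm_zero_iff[OF L2_zero]) (simp add: L2_norm_def)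
    then show "s i \<in> closed_span \<mu> (\<int> \<times> \<int>) torus_char"
      by (intro closed_span_limit[OF torus_char_L2_weight s_L2] bexI[OF _ t]) simp
  next
    show "(\<lambda>i. L2_norm \<mu> (\<lambda>p. s i p - f p)) \<longlonglongrightarrow> 0"
      by (rule L2_dominated_convergence(2)[OF _ _ f2]) (use lim bd in \<open>auto simp: norm_mult\<close>)
  qed
qed

end

subsection \<open>Multiples of characters\<close>

definition char_mult :: "(real \<times> real \<Rightarrow> complex) \<Rightarrow> real \<times> real \<Rightarrow> real \<times> real \<Rightarrow> complex" where
  "char_mult G n p = torus_char n p * G p"

lemma char_mult_L2:
  assumes "G \<in> L2 lborel_Q"
  shows "char_mult G n \<in> L2 lborel_Q"
proof (rule L2_bound[OF _ assms])
  show "char_mult G n \<in> borel_measurable lborel_Q"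
    unfolding char_mult_def using assms by measurable
qed (simp add: char_mult_def norm_mult)

lemma Q_sets: "Q \<in> sets lborel_Q"
  using sets.top[of lborel_Q] by (simp only: space_lborel_Q)

lemma integrable_const_Q: "integrable lborel_Q (\<lambda>p. c :: 'b::{banach, second_countable_topology})"
  using finite_measure.integrable_const[OF finite_measure_lborel_Q] .

context
  fixes G :: "real \<times> real \<Rightarrow> complex"
  assumes G: "G \<in> L2 lborel_Q"
begin

text \<open>Convergence in \<open>L2\<close> of this measure gives two convergences at once: in
  \<open>L2\<close> of the square, hence of Fourier coefficients, from the summand 1, and after
  multiplication by \<open>G\<close> from the other summand. The total mass is finite because
  \<open>G\<close> is in \<open>L2\<close>.\<close>

definition weighted_Q :: "(real \<times> real) measure" where
  "weighted_Q = density lborel_Q (\<lambda>p. ennreal (1 + (cmod (G p))\<^sup>2))"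

lemma G_measurable [measurable]: "G \<in> borel_measurable lborel_Q"
  using G by auto

lemma sets_weighted_Q: "sets weighted_Q = sets lborel_Q"
  by (simp add: weighted_Q_def)

lemma integrable_weight: "integrable lborel_Q (\<lambda>p. 1 + (cmod (G p))\<^sup>2)"
  using L2_integrable[OF G] integrable_const_Q by (rule Bochner_Integration.integrable_add[rotated])

lemma finite_measure_weight: "finite_measure weighted_Q"
proof (rule finite_measureI)
  have "emeasure weighted_Q (space weighted_Q) = (\<integral>\<^sup>+p. ennreal (1 + (cmod (G p))\<^sup>2) \<partial>lborel_Q)"
    unfolding weighted_Q_def by (subst emeasure_density) (auto intro!: nn_integral_cong simp: indicator_def Q_sets)
  also have "\<dots> = ennreal (\<integral>p. 1 + (cmod (G p))\<^sup>2 \<partial>lborel_Q)"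
    by (rule nn_integral_eq_integral[OF integrable_weight]) simp
  finally show "emeasure weighted_Q (space weighted_Q) \<noteq> \<infinity>" by simp
qed

lemma weight_L2_norm:
  assumes f: "f \<in> L2 weighted_Q"
  shows "f \<in> L2 lborel_Q" "L2_norm lborel_Q f \<le> L2_norm weighted_Q f"
    and "(\<lambda>p. f p * G p) \<in> L2 lborel_Q" "L2_norm lborel_Q (\<lambda>p. f p * G p) \<le> L2_norm weighted_Q f"
proof -
  have [measurable]: "f \<in> borel_measurable lborel_Q"
    using L2_measurable[OF f] by (simp add: weighted_Q_def)
  have int: "integrable lborel_Q (\<lambda>p. (1 + (cmod (G p))\<^sup>2) * (cmod (f p))\<^sup>2)"
    using L2_integrable[OF f] unfolding weighted_Q_def
    by (subst (asm) integrable_real_density) auto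
  have norm: "L2_norm weighted_Q f = sqrt (\<integral>p. (1 + (cmod (G p))\<^sup>2) * (cmod (f p))\<^sup>2 \<partial>lborel_Q)"
    unfolding L2_norm_def weighted_Q_def by (subst integral_real_density) auto
  have le1: "(cmod (f p))\<^sup>2 \<le> (1 + (cmod (G p))\<^sup>2) * (cmod (f p))\<^sup>2"
    and le2: "(cmod (f p * G p))\<^sup>2 \<le> (1 + (cmod (G p))\<^sup>2) * (cmod (f p))\<^sup>2" for p
    by (auto simp: norm_mult power_mult_distrib algebra_simps)
  show 1: "f \<in> L2 lborel_Q"
    by (rule L2_I[OF _ Bochner_Integration.integrable_bound[OF int]]) (use le1 in auto)
  show 2: "(\<lambda>p. f p * G p) \<in> L2 lborel_Q"
    by (rule L2_I[OF _ Bochner_Integration.integrable_bound[OF int]]) (use le2 in auto)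
  show "L2_norm lborel_Q f \<le> L2_norm weighted_Q f"
    unfolding norm unfolding L2_norm_def
    by (intro real_sqrt_le_mono integral_mono int L2_integrable 1 le1)
  show "L2_norm lborel_Q (\<lambda>p. f p * G p) \<le> L2_norm weighted_Q f"
    unfolding norm unfolding L2_norm_def
    by (intro real_sqrt_le_mono integral_mono int L2_integrable 2 le2)
qed

lemma bounded_multiple_in_closed_span:
  assumes w: "w \<in> borel_measurable lborel_Q" "\<And>p. cmod (w p) \<le> B"
    and n0: "n0 \<in> \<int> \<times> \<int>" and coeff: "L2_inner lborel_Q w (torus_char n0) = 0"
  shows "(\<lambda>p. w p * G p) \<in> closed_span lborel_Q (\<int> \<times> \<int> - {n0}) (char_mult G)"
  unfolding closed_span_iff
proof (intro conjI allI impI)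
  have w_weight: "w \<in> L2 weighted_Q"
    by (rule bounded_L2[OF finite_measure_weight, of _ B]) (use w in \<open>auto simp: weighted_Q_def\<close>)
  show wG: "(\<lambda>p. w p * G p) \<in> L2 lborel_Q" by (rule weight_L2_norm(3)[OF w_weight])
  have w_Q: "w \<in> L2 lborel_Q" by (rule weight_L2_norm(1)[OF w_weight])
  fix \<epsilon> :: real assume "\<epsilon> > 0"
  define m where "m = L2_norm lborel_Q G"
  \<comment> \<open>One \<open>\<delta>\<close> pays for replacing \<open>w\<close> by
    \<open>t\<close>, and \<open>\<delta> * m\<close> for the dropped term, \<open>m\<close> being
    the norm of each \<open>char_mult G n\<close>.\<close>
  define \<delta> where "\<delta> = \<epsilon> / (m + 1)"
  have "m \<ge> 0" by (simp add: m_def)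
  with \<open>\<epsilon> > 0\<close> have "\<delta> > 0" by (simp add: \<delta>_def)
  obtain t where t: "t \<in> trig_polys" "L2_norm weighted_Q (\<lambda>p. w p - t p) < \<delta>"
    using trig_polys_dense[OF finite_measure_weight sets_weighted_Q w_weight] \<open>\<delta> > 0\<close>
    unfolding closed_span_iff by blast
  then obtain J c where J: "finite J" "J \<subseteq> \<int> \<times> \<int>" "t = (\<lambda>p. \<Sum>n\<in>J. c n * torus_char n p)"
    unfolding lin_span_def by blast
  have t_weight: "t \<in> L2 weighted_Q"
    by (rule lin_span_L2[OF torus_char_L2_weight[OF finite_measure_weight sets_weighted_Q] t(1)])
  note wt = weight_L2_norm[OF L2_diff[OF w_weight t_weight]]
  have t_Q: "t \<in> L2 lborel_Q" by (rule weight_L2_norm(1)[OF t_weight])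
  define a where "a = L2_inner lborel_Q t (torus_char n0)"
  have "a = (\<Sum>n\<in>J. c n * L2_inner lborel_Q (torus_char n) (torus_char n0))"
    unfolding a_def J(3) by (intro L2_inner_sum J torus_char_L2)
  also have "\<dots> = (\<Sum>n\<in>J. if n = n0 then c n else 0)"
  proof (rule sum.cong[OF refl])
    fix n assume "n \<in> J"
    then have "n \<in> \<int> \<times> \<int>" using J(2) by blast
    from torus_char_orthonormal[OF this n0]
    show "c n * L2_inner lborel_Q (torus_char n) (torus_char n0) = (if n = n0 then c n else 0)" by simp
  qed
  also have "\<dots> = (if n0 \<in> J then c n0 else 0)" using J(1) by simp
  finally have a: "a = (if n0 \<in> J then c n0 else 0)" .
  have "a = - L2_inner lborel_Q (\<lambda>p. w p - t p) (torus_char n0)"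
    unfolding a_def by (simp add: L2_inner_diff w_Q t_Q torus_char_L2 coeff)
  then have "cmod a \<le> L2_norm lborel_Q (\<lambda>p. w p - t p) * L2_norm lborel_Q (torus_char n0)"
    using L2_inner_le[OF wt(1) torus_char_L2] by simp
  also have "L2_norm lborel_Q (torus_char n0) = 1"
    using emeasure_lborel_Q by (simp add: L2_norm_def measure_def space_lborel_Q)
  finally have a_le: "cmod a \<le> \<delta>" using wt(2) t(2) by simp
  define h where "h p = (\<Sum>n\<in>J - {n0}. c n * char_mult G n p)" for p
  have h: "h \<in> lin_span (\<int> \<times> \<int> - {n0}) (char_mult G)"
    unfolding lin_span_def h_def using J(1,2) by blast
  have h_eq: "w p * G p - h p = (w p - t p) * G p + a * char_mult G n0 p" for p
  proof -
    have "t p * G p = (\<Sum>n\<in>J. c n * char_mult G n p)"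
      unfolding J(3) sum_distrib_right char_mult_def by (simp add: mult.assoc)
    also have "\<dots> = a * char_mult G n0 p + h p"
      unfolding h_def using J(1) by (simp add: a sum.remove[of J n0])
    finally show ?thesis by (simp add: algebra_simps)
  qed
  have "L2_norm lborel_Q (\<lambda>p. w p * G p - h p)
      \<le> L2_norm lborel_Q (\<lambda>p. (w p - t p) * G p) + L2_norm lborel_Q (\<lambda>p. a * char_mult G n0 p)"
    unfolding h_eq by (intro L2_norm_triangle wt L2_scale char_mult_L2 G)
  also have "L2_norm lborel_Q (\<lambda>p. a * char_mult G n0 p) = cmod a * m"
    unfolding L2_norm_scale m_def by (simp add: char_mult_def L2_norm_def norm_mult)
  also have "L2_norm lborel_Q (\<lambda>p. (w p - t p) * G p) < \<delta>" using wt(4) t(2) by simp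
  also have "cmod a * m \<le> \<delta> * m" using a_le \<open>m \<ge> 0\<close> by (rule mult_right_mono)
  also have "\<delta> + \<delta> * m = \<epsilon>"
  proof -
    have "\<delta> + \<delta> * m = \<delta> * (m + 1)" by (simp add: algebra_simps)
    also have "\<dots> = \<epsilon>" using \<open>m \<ge> 0\<close> by (simp add: \<delta>_def)
    finally show ?thesis .
  qed
  finally show "\<exists>h\<in>lin_span (\<int> \<times> \<int> - {n0}) (char_mult G). L2_norm lborel_Q (\<lambda>p. w p * G p - h p) < \<epsilon>"
    using h by (intro bexI[of _ h]) simp_all
qed

text \<open>
  Writing \<open>F = (F / G) G\<close> and truncating, only the constraint on the Fourier coefficient at \<open>n0\<close>
  is missing. It can be enforced at arbitrarily small cost by subtracting a multiple of
  \<open>V m = 1 / |G|\<^sup>2\<close>, truncated: \<open>\<parallel>V m G\<parallel>\<^sup>2 = \<integral> V m\<close>, and this integral tends to infinity.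
\<close>

theorem char_mult_complete:
  assumes nz: "AE p in lborel_Q. G p \<noteq> 0" and not_L2: "(\<lambda>p. 1 / G p) \<notin> L2 lborel_Q"
    and n0: "n0 \<in> \<int> \<times> \<int>" and F: "F \<in> L2 lborel_Q"
  shows "F \<in> closed_span lborel_Q (\<int> \<times> \<int> - {n0}) (char_mult G)"
proof (rule closed_span_limit[OF char_mult_L2[OF G] F])
  fix \<epsilon> :: real assume "\<epsilon> > 0"
  have [measurable]: "F \<in> borel_measurable lborel_Q" using F by auto
  \<comment> \<open>Truncation makes the quotient a bounded multiplier, and
    \<open>W k p * G p\<close> never exceeds \<open>F p\<close> in modulus, so \<open>F\<close>
    itself is the majorant.\<close>
  define W where "W k p = (if cmod (F p / G p) \<le> real k then F p / G p else 0)" for k p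
  have [measurable]: "W k \<in> borel_measurable lborel_Q" for k unfolding W_def by measurable
  have W_le: "cmod (W k p) \<le> real k" for k p by (simp add: W_def)
  have "(\<lambda>k. L2_norm lborel_Q (\<lambda>p. W k p * G p - F p)) \<longlonglongrightarrow> 0"
  proof (rule L2_dominated_convergence(2)[OF _ _ F])
    show "AE p in lborel_Q. (\<lambda>k. W k p * G p) \<longlonglongrightarrow> F p"
      using nz
    proof eventually_elim
      case (elim p)
      obtain N where "cmod (F p / G p) \<le> real N" using real_arch_simple by blast
      then have "W k p * G p = F p" if "k \<ge> N" for k
        using that elim by (auto simp: W_def)
      then show ?case by (intro tendsto_eventually eventually_sequentiallyI)
    qed
    show "AE p in lborel_Q. cmod (W k p * G p) \<le> cmod (F p)" for k
      by (auto simp: W_def norm_mult norm_divide)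
  qed measurable
  then have "\<forall>\<^sub>F k in sequentially. L2_norm lborel_Q (\<lambda>p. W k p * G p - F p) < \<epsilon> / 2"
    by (rule order_tendstoD(2)) (use \<open>\<epsilon> > 0\<close> in simp)
  then obtain k where k: "L2_norm lborel_Q (\<lambda>p. W k p * G p - F p) < \<epsilon> / 2"
    by (auto dest: eventually_happens)
  define \<alpha> where "\<alpha> = L2_inner lborel_Q (W k) (torus_char n0)"

  \<comment> \<open>Where \<open>G\<close> vanishes, \<open>1 / 0 = 0\<close> makes
    \<open>V m\<close> vanish too, so \<open>(V m p)\<^sup>2 * (cmod (G p))\<^sup>2 = V m p\<close>
    holds at every point.\<close>
  define V where "V m p = (if 1 / (cmod (G p))\<^sup>2 \<le> real m then 1 / (cmod (G p))\<^sup>2 else 0)" for m p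
  have [measurable]: "V m \<in> borel_measurable lborel_Q" for m unfolding V_def by measurable
  have V_bd: "0 \<le> V m p" "V m p \<le> real m" for m p by (auto simp: V_def)
  have V_int: "integrable lborel_Q (V m)" for m
    by (rule finite_measure.integrable_const_bound[OF finite_measure_lborel_Q, of _ "real m"])
       (use V_bd in auto)
  \<comment> \<open>By monotone convergence, bounded integrals of the truncations would make
    \<open>1 / |G|\<^sup>2\<close> integrable.\<close>
  have V_unbounded: "\<exists>m. C < (\<integral>p. V m p \<partial>lborel_Q)" for C
  proof (rule ccontr)
    assume "\<nexists>m. C < (\<integral>p. V m p \<partial>lborel_Q)"
    then have C: "(\<integral>p. V m p \<partial>lborel_Q) \<le> C" for m by (meson not_le)
    have V_mono: "V m p \<le> V m' p" if "m \<le> m'" for m m' p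
      using that by (auto simp: V_def)
    have "incseq (\<lambda>m. \<integral>p. V m p \<partial>lborel_Q)"
      by (intro incseq_SucI integral_mono V_int V_mono) simp
    from incseq_convergent[OF this] C obtain x where x: "(\<lambda>m. \<integral>p. V m p \<partial>lborel_Q) \<longlonglongrightarrow> x"
      by blast
    have "integrable lborel_Q (\<lambda>p. 1 / (cmod (G p))\<^sup>2)"
    proof (rule integrable_monotone_convergence[OF V_int _ _ x])
      show "AE p in lborel_Q. mono (\<lambda>m. V m p)" using V_mono by (simp add: mono_def)
      show "AE p in lborel_Q. (\<lambda>m. V m p) \<longlonglongrightarrow> 1 / (cmod (G p))\<^sup>2"
      proof (rule AE_I2)
        fix p
        obtain N where "1 / (cmod (G p))\<^sup>2 \<le> real N" using real_arch_simple by blast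
        then have "V m p = 1 / (cmod (G p))\<^sup>2" if "m \<ge> N" for m
          using that by (auto simp: V_def)
        then show "(\<lambda>m. V m p) \<longlonglongrightarrow> 1 / (cmod (G p))\<^sup>2"
          by (intro tendsto_eventually eventually_sequentiallyI)
      qed
    qed measurable
    then have "(\<lambda>p. 1 / G p) \<in> L2 lborel_Q"
      by (intro L2_I) (auto simp: norm_divide power_divide)
    with not_L2 show False ..
  qed
  \<comment> \<open>The correction below has norm \<open>cmod \<beta> * sqrt C\<close>, that is
    \<open>cmod \<alpha> / sqrt C\<close>. It is at most \<open>\<epsilon> / 2\<close> once
    \<open>sqrt C\<close> exceeds \<open>r\<close>.\<close>
  define r where "r = 2 * cmod \<alpha> / \<epsilon>"
  obtain m where m: "r\<^sup>2 + 1 < (\<integral>p. V m p \<partial>lborel_Q)" using V_unbounded by blast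
  define C where "C = (\<integral>p. V m p \<partial>lborel_Q)"
  have "r\<^sup>2 < C" using m by (simp add: C_def)
  with zero_le_power2[of r] have C: "r\<^sup>2 < C" "C > 0" by linarith+
  \<comment> \<open>The truncated weight times the character at \<open>n0\<close> has Fourier
    coefficient \<open>C\<close> there, so this multiple cancels \<open>\<alpha>\<close>.\<close>
  define \<beta> where "\<beta> = \<alpha> / of_real C"
  define w where "w p = W k p - \<beta> * (of_real (V m p) * torus_char n0 p)" for p
  have V_Q: "(\<lambda>p. of_real (V m p) * torus_char n0 p) \<in> L2 lborel_Q"
    by (rule bounded_L2[OF finite_measure_lborel_Q, of _ "real m"])
       (use V_bd in \<open>auto simp: norm_mult abs_of_nonneg\<close>)
  have W_Q: "W k \<in> L2 lborel_Q"
    by (rule bounded_L2[OF finite_measure_lborel_Q, of _ "real k"]) (use W_le in auto)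
  have "L2_inner lborel_Q (\<lambda>p. of_real (V m p) * torus_char n0 p) (torus_char n0) = of_real C"
  proof -
    have "of_real (V m p) * torus_char n0 p * cnj (torus_char n0 p) = complex_of_real (V m p)" for p
      using complex_norm_square[of "torus_char n0 p"] by (simp add: mult.assoc)
    then have "L2_inner lborel_Q (\<lambda>p. of_real (V m p) * torus_char n0 p) (torus_char n0)
        = (\<integral>p. complex_of_real (V m p) \<partial>lborel_Q)"
      unfolding L2_inner_def by (simp only:)
    also have "\<dots> = of_real C" unfolding C_def by (rule integral_of_real[OF V_int])
    finally show ?thesis .
  qed
  then have coeff: "L2_inner lborel_Q w (torus_char n0) = 0"
    unfolding w_def L2_inner_diff[OF W_Q L2_scale[OF V_Q] torus_char_L2] L2_inner_scale \<alpha>_def[symmetric]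
    using C(2) by (simp add: \<beta>_def)
  have [measurable]: "w \<in> borel_measurable lborel_Q" unfolding w_def by measurable
  have w_le: "cmod (w p) \<le> real k + cmod \<beta> * real m" for p
    unfolding w_def using V_bd[of m p] W_le[of k p]
    by (intro order_trans[OF norm_triangle_ineq4] add_mono)
       (auto simp: norm_mult abs_of_nonneg intro!: mult_left_mono)
  have wG: "(\<lambda>p. w p * G p) \<in> closed_span lborel_Q (\<int> \<times> \<int> - {n0}) (char_mult G)"
    by (rule bounded_multiple_in_closed_span[OF _ w_le n0 coeff]) measurable
  have VG_norm: "L2_norm lborel_Q (\<lambda>p. of_real (V m p) * char_mult G n0 p) = sqrt C"
  proof -
    have "(cmod (of_real (V m p) * char_mult G n0 p))\<^sup>2 = V m p" for p
      by (simp add: char_mult_def norm_mult power_mult_distrib V_def)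
         (simp add: power2_eq_square)
    then show ?thesis by (simp add: L2_norm_def C_def)
  qed
  have VG: "(\<lambda>p. of_real (V m p) * char_mult G n0 p) \<in> L2 lborel_Q"
  proof (rule L2_bound[OF _ L2_scale[OF char_mult_L2[OF G, of n0], of "of_nat m"]])
    show "(\<lambda>p. of_real (V m p) * char_mult G n0 p) \<in> borel_measurable lborel_Q"
      unfolding char_mult_def by measurable
    show "AE p in lborel_Q. cmod (of_real (V m p) * char_mult G n0 p) \<le> cmod (of_nat m * char_mult G n0 p)"
      using V_bd by (intro AE_I2) (auto simp: norm_mult abs_of_nonneg intro!: mult_right_mono)
  qed
  have WG: "(\<lambda>p. W k p * G p) \<in> L2 lborel_Q"
  proof (rule L2_bound[OF _ L2_scale[OF G, of "of_nat k"]])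
    show "AE p in lborel_Q. cmod (W k p * G p) \<le> cmod (of_nat k * G p)"
      using W_le by (intro AE_I2) (auto simp: norm_mult intro!: mult_right_mono)
  qed measurable
  have "(\<lambda>p. F p - w p * G p) = (\<lambda>p. (F p - W k p * G p) + \<beta> * (of_real (V m p) * char_mult G n0 p))"
    by (simp add: w_def char_mult_def algebra_simps)
  then have "L2_norm lborel_Q (\<lambda>p. F p - w p * G p)
      \<le> L2_norm lborel_Q (\<lambda>p. F p - W k p * G p) + L2_norm lborel_Q (\<lambda>p. \<beta> * (of_real (V m p) * char_mult G n0 p))"
    using L2_norm_triangle[OF L2_diff[OF F WG] L2_scale[OF VG]] by simp
  also have "L2_norm lborel_Q (\<lambda>p. \<beta> * (of_real (V m p) * char_mult G n0 p)) = cmod \<alpha> / sqrt C"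
    unfolding L2_norm_scale VG_norm using C(2) by (simp add: \<beta>_def norm_divide real_div_sqrt field_simps)
  also have "cmod \<alpha> / sqrt C \<le> \<epsilon> / 2"
  proof -
    have "r < sqrt C" using C(1) by (rule real_less_rsqrt)
    then show ?thesis using \<open>\<epsilon> > 0\<close> C(2) by (simp add: r_def field_simps)
  qed
  finally have "L2_norm lborel_Q (\<lambda>p. F p - w p * G p) < \<epsilon>"
    using k by (simp add: L2_norm_minus_commute[of _ F])
  with wG show "\<exists>h\<in>closed_span lborel_Q (\<int> \<times> \<int> - {n0}) (char_mult G). L2_norm lborel_Q (\<lambda>p. F p - h p) < \<epsilon>"
    by (intro bexI[of _ "\<lambda>p. w p * G p"])
qed

end

subsection \<open>The Zak transform\<close>

lemma L2_norm_Pythagoras: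
  assumes "finite J" "\<And>i. i \<in> J \<Longrightarrow> u i \<in> L2 M"
    and "\<And>i j. i \<in> J \<Longrightarrow> j \<in> J \<Longrightarrow> i \<noteq> j \<Longrightarrow> L2_inner M (u i) (u j) = 0"
  shows "(L2_norm M (\<lambda>x. \<Sum>i\<in>J. u i x))\<^sup>2 = (\<Sum>i\<in>J. (L2_norm M (u i))\<^sup>2)"
  using assms
proof (induction J rule: finite_induct)
  case empty
  then show ?case by (simp add: L2_norm_def)
next
  case (insert i J)
  define v where "v x = (\<Sum>j\<in>J. u j x)" for x
  have v: "v \<in> L2 M" and ui: "u i \<in> L2 M"
    unfolding v_def using insert.prems(1) by (auto intro!: L2_sum)
  have "L2_inner M v (u i) = L2_inner M (\<lambda>x. \<Sum>j\<in>J. 1 * u j x) (u i)" by (simp add: v_def[abs_def])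
  also have "\<dots> = 0"
    using insert by (subst L2_inner_sum) (auto intro!: sum.neutral)
  finally have orth: "L2_inner M v (u i) = 0" .
  have sq: "(cmod (a + b))\<^sup>2 = (cmod a)\<^sup>2 + (cmod b)\<^sup>2 + 2 * Re (b * cnj a)" for a b
    by (simp only: cmod_power2) (simp add: power2_eq_square algebra_simps)
  have "(L2_norm M (\<lambda>x. u i x + v x))\<^sup>2 = (\<integral>x. (cmod (u i x))\<^sup>2 + (cmod (v x))\<^sup>2 + 2 * Re (v x * cnj (u i x)) \<partial>M)"
    unfolding L2_norm_square sq ..
  also have "\<dots> = (L2_norm M (u i))\<^sup>2 + (L2_norm M v)\<^sup>2 + 2 * Re (L2_inner M v (u i))"
    using L2_integrable[OF v] L2_integrable[OF ui] L2_mult_cnj_integrable[OF v ui]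
    unfolding L2_norm_square L2_inner_def by (simp del: times_complex.sel)
  finally have "(L2_norm M (\<lambda>x. u i x + v x))\<^sup>2 = (L2_norm M (u i))\<^sup>2 + (L2_norm M v)\<^sup>2"
    using orth by simp
  moreover have "(L2_norm M v)\<^sup>2 = (\<Sum>j\<in>J. (L2_norm M (u j))\<^sup>2)"
    unfolding v_def using insert by auto
  ultimately show ?case using insert.hyps by (simp add: v_def)
qed

definition zak_term :: "(real \<Rightarrow> complex) \<Rightarrow> int \<Rightarrow> real \<times> real \<Rightarrow> complex" where
  "zak_term f j p = f (fst p - of_int j) * cis (2 * pi * of_int j * snd p)"

definition zak_sum :: "(real \<Rightarrow> complex) \<Rightarrow> int set \<Rightarrow> real \<times> real \<Rightarrow> complex" where
  "zak_sum f J p = (\<Sum>j\<in>J. zak_term f j p)"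

lemma has_zak_transform_iff:
  "has_zak_transform f F \<longleftrightarrow> F \<in> L2 lborel_Q \<and>
    ((\<lambda>J. L2_norm lborel_Q (\<lambda>p. F p - zak_sum f J p)) \<longlongrightarrow> 0) (finite_subsets_at_top UNIV)"
  by (simp add: has_zak_transform_def zak_sum_def zak_term_def case_prod_beta')

text \<open>As \<open>x\<close> runs through the unit interval, \<open>f (x - j)\<close> sees
  \<open>f\<close> on the interval from \<open>-j\<close> to \<open>1 - j\<close>, whose points have
  floor \<open>-j\<close>; hence the sign.\<close>

definition unit_cells :: "int set \<Rightarrow> real set" where
  "unit_cells J = {t. - \<lfloor>t\<rfloor> \<in> J}"

lemma unit_cells_borel [measurable]: "unit_cells J \<in> sets borel"
proof -
  have "unit_cells J = (\<lambda>t :: real. \<lfloor>t\<rfloor>) -` uminus ` J \<inter> space borel"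
    by (auto simp: unit_cells_def image_iff intro: bexI[of _ "- \<lfloor>_\<rfloor>"])
       (metis minus_minus)
  also have "\<dots> \<in> sets borel" by (rule measurable_sets[OF measurable_real_floor]) simp
  finally show ?thesis .
qed

lemma integrable_shift:
  fixes f :: "real \<Rightarrow> 'a::{banach, second_countable_topology}"
  assumes "integrable lborel f"
  shows "integrable lborel (\<lambda>x. f (x - a))"
  using lborel_integrable_real_affine[OF assms, of 1 "- a"] by (simp add: algebra_simps)

lemma integral_shift:
  fixes f :: "real \<Rightarrow> 'a::{banach, second_countable_topology}"
  shows "(\<integral>x. f (x - a) \<partial>lborel) = (\<integral>x. f x \<partial>lborel)"
  using lborel_integral_real_affine[of 1 f "- a"] by (simp add: algebra_simps)

lemma set_integral_unit: "(LINT \<xi>:{0..<1::real}|lborel. c) = (c :: real)"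
  by (simp add: set_lebesgue_integral_def)

lemma fst_borel_measurable [measurable]: "(fst :: real \<times> real \<Rightarrow> real) \<in> borel \<rightarrow>\<^sub>M borel"
  unfolding borel_prod[symmetric] by measurable

lemma zak_sum_diff:
  assumes "finite J" "K \<subseteq> J"
  shows "zak_sum f J p - zak_sum f K p = zak_sum f (J - K) p"
  using assms by (simp add: zak_sum_def sum_diff)

context
  fixes f :: "real \<Rightarrow> complex"
  assumes f: "f \<in> L2 lborel"
begin

lemma f_measurable [measurable]: "f \<in> borel_measurable borel"
  using L2_measurable[OF f] by simp

lemma zak_term_measurable [measurable]: "zak_term f j \<in> borel_measurable borel"
  unfolding zak_term_def borel_prod[symmetric] by measurable

lemma zak_term_L2: "zak_term f j \<in> L2 lborel_Q"
proof (rule L2_I)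
  show "zak_term f j \<in> borel_measurable lborel_Q"
    by (intro measurable_restrict_space1) simp
  let ?h = "\<lambda>p. indicator Q p *\<^sub>R (cmod (f (fst p - of_int j)))\<^sup>2"
  have "integrable (lborel \<Otimes>\<^sub>M lborel) ?h"
  proof (rule lborel_pair.Fubini_integrable)
    show "?h \<in> borel_measurable (lborel \<Otimes>\<^sub>M lborel)"
      unfolding lborel_prod measurable_lborel2 by measurable
    have 1: "?h (x, \<xi>) = indicator {0..<1} x * (cmod (f (x - of_int j)))\<^sup>2 * indicator {0..<1} \<xi>" for x \<xi>
      by (simp add: Q_def indicator_times)
    have "integrable lborel (\<lambda>x. indicator {0..<1} x *\<^sub>R (cmod (f (x - of_int j)))\<^sup>2)"
      using integrable_shift[OF L2_integrable[OF f]] by (intro integrable_mult_indicator) auto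
    then show "integrable lborel (\<lambda>x. \<integral>\<xi>. norm (?h (x, \<xi>)) \<partial>lborel)"
      unfolding 1 by (simp add: abs_mult)
    show "AE x in lborel. integrable lborel (\<lambda>\<xi>. ?h (x, \<xi>))"
      unfolding 1 by simp
  qed
  then have "integrable lborel_Q (\<lambda>p. (cmod (f (fst p - of_int j)))\<^sup>2)"
    by (simp add: integrable_restrict_space lborel_prod)
  then show "integrable lborel_Q (\<lambda>p. (cmod (zak_term f j p))\<^sup>2)"
    by (simp add: zak_term_def norm_mult)
qed

lemma zak_sum_L2: "zak_sum f J \<in> L2 lborel_Q"
  unfolding zak_sum_def[abs_def] by (intro L2_sum zak_term_L2)

lemma zak_term_norm:
  "(L2_norm lborel_Q (zak_term f j))\<^sup>2 = (\<integral>t. indicator (unit_cells {j}) t * (cmod (f t))\<^sup>2 \<partial>lborel)"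
proof -
  have "(L2_norm lborel_Q (zak_term f j))\<^sup>2
      = (LINT x:{0..<1}|lborel. (LINT \<xi>:{0..<1}|lborel. (cmod (zak_term f j (x, \<xi>)))\<^sup>2))"
    unfolding L2_norm_square by (rule integral_lborel_Q[OF L2_integrable[OF zak_term_L2]])
  also have "\<dots> = (LINT x:{0..<1}|lborel. (cmod (f (x - of_int j)))\<^sup>2)"
    by (simp add: zak_term_def norm_mult set_integral_unit)
  also have "\<dots> = (\<integral>x. indicator (unit_cells {j}) (x - of_int j) * (cmod (f (x - of_int j)))\<^sup>2 \<partial>lborel)"
    unfolding set_lebesgue_integral_def
    by (intro Bochner_Integration.integral_cong refl)
       (auto simp: indicator_def unit_cells_def floor_eq_iff)
  also have "\<dots> = (\<integral>t. indicator (unit_cells {j}) t * (cmod (f t))\<^sup>2 \<partial>lborel)"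
    by (rule integral_shift)
  finally show ?thesis .
qed

text \<open>Integration in the second variable alone gives zero: the exponentials of two different
  indices multiply to a nontrivial one over full periods.\<close>

lemma zak_term_orthogonal:
  assumes "j \<noteq> k"
  shows "L2_inner lborel_Q (zak_term f j) (zak_term f k) = 0"
proof -
  have "L2_inner lborel_Q (zak_term f j) (zak_term f k)
      = (LINT x:{0..<1}|lborel. (LINT \<xi>:{0..<1}|lborel. zak_term f j (x, \<xi>) * cnj (zak_term f k (x, \<xi>))))"
    unfolding L2_inner_def by (rule integral_lborel_Q[OF L2_mult_cnj_integrable[OF zak_term_L2 zak_term_L2]])
  also have "\<dots> = (LINT x:{0..<1}|lborel. f (x - of_int j) * cnj (f (x - of_int k)) *
      (LINT \<xi>:{0..<1}|lborel. cis (2 * pi * (of_int (j - k) * \<xi>))))"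
  proof -
    have "zak_term f j (x, \<xi>) * cnj (zak_term f k (x, \<xi>))
        = f (x - of_int j) * cnj (f (x - of_int k)) * cis (2 * pi * (of_int (j - k) * \<xi>))" for x \<xi>
    proof -
      have "cis (2 * pi * of_int j * \<xi>) * cis (- (2 * pi * of_int k * \<xi>)) = cis (2 * pi * (of_int (j - k) * \<xi>))"
        by (simp add: cis_mult algebra_simps)
      then show ?thesis
        unfolding zak_term_def by (simp add: cis_cnj mult_ac)
    qed
    then show ?thesis by simp
  qed
  also have "\<dots> = 0"
    using assms by (subst integral_cis_period) auto
  finally show ?thesis .
qed

text \<open>Pythagoras adds up the terms, and their cells are disjoint. Finite sums are thus exactly
  isometric to \<open>f\<close> cut off to finitely many cells.\<close>

lemma zak_sum_norm:
  assumes "finite J"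
  shows "(L2_norm lborel_Q (zak_sum f J))\<^sup>2 = (\<integral>t. indicator (unit_cells J) t * (cmod (f t))\<^sup>2 \<partial>lborel)"
proof -
  have int: "integrable lborel (\<lambda>t. indicator (unit_cells {j}) t * (cmod (f t))\<^sup>2)" for j
    using integrable_mult_indicator[OF _ L2_integrable[OF f], of "unit_cells {j}"] by simp
  have "(L2_norm lborel_Q (zak_sum f J))\<^sup>2 = (\<Sum>j\<in>J. (L2_norm lborel_Q (zak_term f j))\<^sup>2)"
    unfolding zak_sum_def[abs_def]
    by (intro L2_norm_Pythagoras zak_term_L2 zak_term_orthogonal assms)
  also have "\<dots> = (\<integral>t. (\<Sum>j\<in>J. indicator (unit_cells {j}) t * (cmod (f t))\<^sup>2) \<partial>lborel)"
    unfolding zak_term_norm using int by simp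
  also have "\<dots> = (\<integral>t. indicator (unit_cells J) t * (cmod (f t))\<^sup>2 \<partial>lborel)"
  proof (intro Bochner_Integration.integral_cong refl)
    fix t
    have "(\<Sum>j\<in>J. indicator (unit_cells {j}) t * (cmod (f t))\<^sup>2)
        = (\<Sum>j\<in>J. if - \<lfloor>t\<rfloor> = j then (cmod (f t))\<^sup>2 else 0)"
      by (intro sum.cong) (auto simp: unit_cells_def)
    also have "\<dots> = indicator (unit_cells J) t * (cmod (f t))\<^sup>2"
      using assms by (simp add: unit_cells_def indicator_def)
    finally show "(\<Sum>j\<in>J. indicator (unit_cells {j}) t * (cmod (f t))\<^sup>2)
        = indicator (unit_cells J) t * (cmod (f t))\<^sup>2" .
  qed
  finally show ?thesis .
qed

text \<open>Dominated convergence for the complements of \<open>{-n..n}\<close>, then monotonicity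
  in \<open>J\<close>. The sets \<open>J\<close> may be infinite: the isometry uses the complement
  of a finite set.\<close>

lemma unit_cells_tail:
  assumes "\<epsilon> > 0"
  shows "\<exists>n::int. \<forall>J. J \<inter> {-n..n} = {} \<longrightarrow> (\<integral>t. indicator (unit_cells J) t * (cmod (f t))\<^sup>2 \<partial>lborel) < \<epsilon>"
proof -
  let ?I = "\<lambda>J. \<integral>t. indicator (unit_cells J) t * (cmod (f t))\<^sup>2 \<partial>lborel"
  have int: "integrable lborel (\<lambda>t. indicator (unit_cells J) t * (cmod (f t))\<^sup>2)" for J
    using integrable_mult_indicator[OF _ L2_integrable[OF f], of "unit_cells J"] by simp
  have "(\<lambda>n. ?I (- {- int n..int n})) \<longlonglongrightarrow> (\<integral>t. 0 \<partial>(lborel :: real measure))"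
  proof (rule integral_dominated_convergence[OF _ _ L2_integrable[OF f]])
    show "AE t in lborel. (\<lambda>n. indicator (unit_cells (- {- int n..int n})) t * (cmod (f t))\<^sup>2) \<longlonglongrightarrow> 0"
    proof (rule AE_I2)
      fix t :: real
      have "indicator (unit_cells (- {- int n..int n})) t * (cmod (f t))\<^sup>2 = 0" if "n \<ge> nat \<bar>\<lfloor>t\<rfloor>\<bar>" for n
        using that by (auto simp: unit_cells_def indicator_def)
      then show "(\<lambda>n. indicator (unit_cells (- {- int n..int n})) t * (cmod (f t))\<^sup>2) \<longlonglongrightarrow> 0"
        by (intro tendsto_eventually eventually_sequentiallyI)
    qed
    show "AE t in lborel. norm (indicator (unit_cells (- {- int n..int n})) t * (cmod (f t))\<^sup>2) \<le> (cmod (f t))\<^sup>2" for n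
      by (auto simp: indicator_def)
  qed measurable
  then have "\<forall>\<^sub>F n in sequentially. ?I (- {- int n..int n}) < \<epsilon>"
    by (rule order_tendstoD(2)) (use assms in simp)
  then obtain n where n: "?I (- {- int n..int n}) < \<epsilon>"
    by (auto dest: eventually_happens)
  have "?I J < \<epsilon>" if "J \<inter> {- int n..int n} = {}" for J
  proof -
    have "?I J \<le> ?I (- {- int n..int n})"
      using that by (intro integral_mono int mult_right_mono) (auto simp: indicator_def unit_cells_def)
    with n show ?thesis by simp
  qed
  then show ?thesis by blast
qed

lemma zak_sum_tail:
  assumes "\<epsilon> > 0"
  shows "\<exists>n::int. \<forall>J. finite J \<longrightarrow> J \<inter> {-n..n} = {} \<longrightarrow> L2_norm lborel_Q (zak_sum f J) < \<epsilon>"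
proof -
  obtain n where n: "\<And>J. J \<inter> {-n..n} = {} \<Longrightarrow>
      (\<integral>t. indicator (unit_cells J) t * (cmod (f t))\<^sup>2 \<partial>lborel) < \<epsilon>\<^sup>2"
    using unit_cells_tail[OF zero_less_power[OF assms, of 2]] by blast
  show ?thesis
  proof (intro exI[of _ n] allI impI)
    fix J :: "int set" assume "finite J" "J \<inter> {-n..n} = {}"
    then have "(L2_norm lborel_Q (zak_sum f J))\<^sup>2 < \<epsilon>\<^sup>2" by (simp only: n zak_sum_norm)
    then show "L2_norm lborel_Q (zak_sum f J) < \<epsilon>"
      by (rule power2_less_imp_less) (use assms in linarith)
  qed
qed

text \<open>A limit is found along one increasing sequence of finite sets \<open>K k\<close>. All
  finite sums avoiding \<open>K k\<close> are uniformly small, and this upgrades the convergence to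
  the whole net.\<close>

theorem has_zak_transform_exists: "\<exists>F. has_zak_transform f F"
proof -
  have "\<exists>n. \<forall>J. finite J \<longrightarrow> J \<inter> {-n..n} = {} \<longrightarrow> L2_norm lborel_Q (zak_sum f J) < (1/2) ^ k" for k :: nat
    by (rule zak_sum_tail) simp
  then obtain n where n: "\<And>k J. finite J \<Longrightarrow> J \<inter> {- n k..n k} = {} \<Longrightarrow> L2_norm lborel_Q (zak_sum f J) < (1/2) ^ k"
    by metis
  \<comment> \<open>The union makes the sets increase with \<open>k\<close>; the numbers
    \<open>n k\<close> chosen for the separate tails need not be monotone.\<close>
  define K where "K k = (\<Union>i\<le>k. {- n i..n i})" for k
  have K: "finite (K k)" "{- n k..n k} \<subseteq> K k" "K k \<subseteq> K (Suc k)" for k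
    by (auto simp: K_def atMost_Suc)
  have tail: "L2_norm lborel_Q (zak_sum f (J - K k)) < (1/2) ^ k" if "finite J" for J k
    using that K(2) by (intro n) auto
  obtain F where F: "F \<in> L2 lborel_Q" and lim: "(\<lambda>k. L2_norm lborel_Q (\<lambda>p. zak_sum f (K k) p - F p)) \<longlonglongrightarrow> 0"
  proof (rule L2_complete[of "\<lambda>k. zak_sum f (K k)" lborel_Q "\<lambda>k. (1/2) ^ k"])
    show "L2_norm lborel_Q (\<lambda>p. zak_sum f (K (Suc k)) p - zak_sum f (K k) p) \<le> (1/2) ^ k" for k
      unfolding zak_sum_diff[OF K(1,3)] using tail[OF K(1)] less_imp_le by blast
  qed (auto intro: zak_sum_L2 summable_geometric)
  have "((\<lambda>J. L2_norm lborel_Q (\<lambda>p. F p - zak_sum f J p)) \<longlongrightarrow> 0) (finite_subsets_at_top UNIV)"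
  proof (rule tendstoI)
    fix \<epsilon> :: real assume "\<epsilon> > 0"
    have "(\<lambda>k. L2_norm lborel_Q (\<lambda>p. zak_sum f (K k) p - F p) + (1/2) ^ k) \<longlonglongrightarrow> 0 + 0"
      by (intro tendsto_add lim LIMSEQ_realpow_zero) auto
    then have "\<forall>\<^sub>F k in sequentially. L2_norm lborel_Q (\<lambda>p. zak_sum f (K k) p - F p) + (1/2) ^ k < \<epsilon>"
      by (rule order_tendstoD(2)) (use \<open>\<epsilon> > 0\<close> in simp)
    then obtain k where k: "L2_norm lborel_Q (\<lambda>p. zak_sum f (K k) p - F p) + (1/2) ^ k < \<epsilon>"
      by (auto dest: eventually_happens)
    show "\<forall>\<^sub>F J in finite_subsets_at_top UNIV. dist (L2_norm lborel_Q (\<lambda>p. F p - zak_sum f J p)) 0 < \<epsilon>"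
      unfolding eventually_finite_subsets_at_top
    proof (intro exI[of _ "K k"] conjI allI impI)
      fix J :: "int set" assume J: "finite J \<and> K k \<subseteq> J \<and> J \<subseteq> UNIV"
      have "L2_norm lborel_Q (\<lambda>p. F p - zak_sum f J p)
          \<le> L2_norm lborel_Q (\<lambda>p. F p - zak_sum f (K k) p) + L2_norm lborel_Q (\<lambda>p. zak_sum f (K k) p - zak_sum f J p)"
        by (intro L2_norm_triangle_diff F zak_sum_L2)
      also have "L2_norm lborel_Q (\<lambda>p. zak_sum f (K k) p - zak_sum f J p) = L2_norm lborel_Q (zak_sum f (J - K k))"
        using J by (subst L2_norm_minus_commute) (simp add: zak_sum_diff)
      also have "\<dots> < (1/2) ^ k" using J by (intro tail) simp
      finally show "dist (L2_norm lborel_Q (\<lambda>p. F p - zak_sum f J p)) 0 < \<epsilon>"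
        using k by (simp add: L2_norm_minus_commute[of _ F])
    qed (use K in auto)
  qed
  with F show ?thesis unfolding has_zak_transform_iff by blast
qed

text \<open>The norms of the finite sums tend to that of \<open>f\<close> because the tails vanish,
  and to that of \<open>F\<close> by the triangle inequality. The result covers every representative
  \<open>F\<close>.\<close>

theorem zak_isometry:
  assumes F: "has_zak_transform f F"
  shows "L2_norm lborel_Q F = L2_norm lborel f"
proof -
  let ?N = "\<lambda>J. L2_norm lborel_Q (zak_sum f J)"
  have FL: "F \<in> L2 lborel_Q" using F by (simp add: has_zak_transform_iff)
  have int: "integrable lborel (\<lambda>t. indicator (unit_cells J) t * (cmod (f t))\<^sup>2)" for J
    using integrable_mult_indicator[OF _ L2_integrable[OF f], of "unit_cells J"] by simp
  have "((\<lambda>J. (?N J)\<^sup>2) \<longlongrightarrow> (L2_norm lborel f)\<^sup>2) (finite_subsets_at_top UNIV)"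
  proof (rule tendstoI)
    fix \<epsilon> :: real assume "\<epsilon> > 0"
    then obtain n where n: "\<And>J. J \<inter> {-n..n} = {} \<Longrightarrow>
        (\<integral>t. indicator (unit_cells J) t * (cmod (f t))\<^sup>2 \<partial>lborel) < \<epsilon>"
      using unit_cells_tail by blast
    show "\<forall>\<^sub>F J in finite_subsets_at_top UNIV. dist ((?N J)\<^sup>2) ((L2_norm lborel f)\<^sup>2) < \<epsilon>"
      unfolding eventually_finite_subsets_at_top
    proof (intro exI[of _ "{-n..n}"] conjI allI impI)
      fix J assume J: "finite J \<and> {-n..n} \<subseteq> J \<and> J \<subseteq> UNIV"
      have "(L2_norm lborel f)\<^sup>2 = (\<integral>t. indicator (unit_cells J) t * (cmod (f t))\<^sup>2
          + indicator (unit_cells (- J)) t * (cmod (f t))\<^sup>2 \<partial>lborel)"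
        unfolding L2_norm_square
        by (intro Bochner_Integration.integral_cong refl) (auto simp: indicator_def unit_cells_def)
      also have "\<dots> = (?N J)\<^sup>2 + (\<integral>t. indicator (unit_cells (- J)) t * (cmod (f t))\<^sup>2 \<partial>lborel)"
        using J by (simp add: int zak_sum_norm)
      finally have "dist ((?N J)\<^sup>2) ((L2_norm lborel f)\<^sup>2)
          = (\<integral>t. indicator (unit_cells (- J)) t * (cmod (f t))\<^sup>2 \<partial>lborel)"
        by (simp add: dist_norm integral_nonneg_AE)
      also have "\<dots> < \<epsilon>" using J by (intro n) auto
      finally show "dist ((?N J)\<^sup>2) ((L2_norm lborel f)\<^sup>2) < \<epsilon>" .
    qed auto
  qed
  then have "((\<lambda>J. sqrt ((?N J)\<^sup>2)) \<longlongrightarrow> sqrt ((L2_norm lborel f)\<^sup>2)) (finite_subsets_at_top UNIV)"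
    by (rule tendsto_real_sqrt)
  then have lim1: "(?N \<longlongrightarrow> L2_norm lborel f) (finite_subsets_at_top UNIV)" by simp
  have "((\<lambda>J. L2_norm lborel_Q F - ?N J) \<longlongrightarrow> 0) (finite_subsets_at_top UNIV)"
  proof (rule Lim_null_comparison)
    show "\<forall>\<^sub>F J in finite_subsets_at_top UNIV.
        norm (L2_norm lborel_Q F - ?N J) \<le> L2_norm lborel_Q (\<lambda>p. F p - zak_sum f J p)"
      using L2_norm_triangle_minus[OF FL zak_sum_L2] by simp
    show "((\<lambda>J. L2_norm lborel_Q (\<lambda>p. F p - zak_sum f J p)) \<longlongrightarrow> 0) (finite_subsets_at_top UNIV)"
      using F by (simp add: has_zak_transform_iff)
  qed
  from tendsto_diff[OF tendsto_const[of "L2_norm lborel_Q F"] this]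
  have "(?N \<longlongrightarrow> L2_norm lborel_Q F) (finite_subsets_at_top UNIV)" by simp
  from tendsto_unique[OF finite_subsets_at_top_neq_bot this lim1] show ?thesis .
qed

end

section \<open>Linearity of the Zak transform\<close>

lemma has_zak_transform_add:
  assumes f: "f \<in> L2 lborel" "has_zak_transform f F" and h: "h \<in> L2 lborel" "has_zak_transform h H"
  shows "has_zak_transform (\<lambda>x. f x + h x) (\<lambda>p. F p + H p)"
  unfolding has_zak_transform_iff
proof
  have FH: "F \<in> L2 lborel_Q" "H \<in> L2 lborel_Q" using f h by (auto simp: has_zak_transform_iff)
  then show "(\<lambda>p. F p + H p) \<in> L2 lborel_Q" by (rule L2_add)
  show "((\<lambda>J. L2_norm lborel_Q (\<lambda>p. F p + H p - zak_sum (\<lambda>x. f x + h x) J p)) \<longlongrightarrow> 0) (finite_subsets_at_top UNIV)"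
  proof (rule Lim_null_comparison)
    have "L2_norm lborel_Q (\<lambda>p. F p + H p - zak_sum (\<lambda>x. f x + h x) J p)
        \<le> L2_norm lborel_Q (\<lambda>p. F p - zak_sum f J p) + L2_norm lborel_Q (\<lambda>p. H p - zak_sum h J p)" for J
    proof -
      have "zak_sum (\<lambda>x. f x + h x) J p = zak_sum f J p + zak_sum h J p" for p
        by (simp add: zak_sum_def zak_term_def ring_distribs sum.distrib)
      then show ?thesis
        using L2_norm_triangle[OF L2_diff[OF FH(1) zak_sum_L2[OF f(1)]] L2_diff[OF FH(2) zak_sum_L2[OF h(1)]], of J J]
        by (simp add: algebra_simps)
    qed
    then show "\<forall>\<^sub>F J in finite_subsets_at_top UNIV.
        norm (L2_norm lborel_Q (\<lambda>p. F p + H p - zak_sum (\<lambda>x. f x + h x) J p))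
          \<le> L2_norm lborel_Q (\<lambda>p. F p - zak_sum f J p) + L2_norm lborel_Q (\<lambda>p. H p - zak_sum h J p)"
      by simp
    show "((\<lambda>J. L2_norm lborel_Q (\<lambda>p. F p - zak_sum f J p) + L2_norm lborel_Q (\<lambda>p. H p - zak_sum h J p)) \<longlongrightarrow> 0)
        (finite_subsets_at_top UNIV)"
    proof -
      have "((\<lambda>J. L2_norm lborel_Q (\<lambda>p. F p - zak_sum f J p)) \<longlongrightarrow> 0) (finite_subsets_at_top UNIV)"
        and "((\<lambda>J. L2_norm lborel_Q (\<lambda>p. H p - zak_sum h J p)) \<longlongrightarrow> 0) (finite_subsets_at_top UNIV)"
        using f h by (auto simp: has_zak_transform_iff)
      from tendsto_add[OF this] show ?thesis by simp
    qed
  qed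
qed

lemma has_zak_transform_scale:
  assumes "has_zak_transform f F"
  shows "has_zak_transform (\<lambda>x. c * f x) (\<lambda>p. c * F p)"
  unfolding has_zak_transform_iff
proof
  show "(\<lambda>p. c * F p) \<in> L2 lborel_Q" using assms by (auto simp: has_zak_transform_iff intro: L2_scale)
  have "zak_sum (\<lambda>x. c * f x) J p = c * zak_sum f J p" for J p
    by (simp add: zak_sum_def zak_term_def sum_distrib_left mult.assoc)
  then have eq: "L2_norm lborel_Q (\<lambda>p. c * F p - zak_sum (\<lambda>x. c * f x) J p)
      = cmod c * L2_norm lborel_Q (\<lambda>p. F p - zak_sum f J p)" for J
    by (simp add: L2_norm_scale right_diff_distrib[symmetric])
  show "((\<lambda>J. L2_norm lborel_Q (\<lambda>p. c * F p - zak_sum (\<lambda>x. c * f x) J p)) \<longlongrightarrow> 0) (finite_subsets_at_top UNIV)"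
    unfolding eq using assms by (intro tendsto_mult_right_zero) (simp add: has_zak_transform_iff)
qed

lemma has_zak_transform_diff:
  assumes f: "f \<in> L2 lborel" "has_zak_transform f F" and h: "h \<in> L2 lborel" "has_zak_transform h H"
  shows "has_zak_transform (\<lambda>x. f x - h x) (\<lambda>p. F p - H p)"
  using has_zak_transform_add[OF f L2_scale[OF h(1)] has_zak_transform_scale[OF h(2)], of "-1"] by simp

lemma has_zak_transform_sum:
  assumes "finite J" "\<And>i. i \<in> J \<Longrightarrow> f i \<in> L2 lborel" "\<And>i. i \<in> J \<Longrightarrow> has_zak_transform (f i) (F i)"
  shows "has_zak_transform (\<lambda>x. \<Sum>i\<in>J. c i * f i x) (\<lambda>p. \<Sum>i\<in>J. c i * F i p)"
  using assms
proof (induction J rule: finite_induct)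
  case empty
  show ?case by (simp add: has_zak_transform_iff zak_sum_def zak_term_def L2_zero L2_norm_def)
next
  case (insert i J)
  have "has_zak_transform (\<lambda>x. c i * f i x + (\<Sum>i\<in>J. c i * f i x)) (\<lambda>p. c i * F i p + (\<Sum>i\<in>J. c i * F i p))"
    using insert by (intro has_zak_transform_add has_zak_transform_scale L2_scale L2_sum) auto
  with insert show ?case by simp
qed

section \<open>Gabor elements and their Zak transforms\<close>

lemma gabor_L2:
  assumes g: "g \<in> L2 lborel"
  shows "gabor g n \<in> L2 lborel"
proof (cases n)
  case (Pair a b)
  have [measurable]: "g \<in> borel_measurable borel" using L2_measurable[OF g] by simp
  have "integrable lborel (\<lambda>t. (cmod (g (t - a)))\<^sup>2)"
    by (rule integrable_shift[OF L2_integrable[OF g]])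
  then show ?thesis
    by (intro L2_I) (auto simp: Pair gabor_def modulation_def[abs_def] translation_def norm_mult)
qed

lemma gabor_norm: "L2_norm lborel (gabor g n) = L2_norm lborel g"
  using integral_shift[of "\<lambda>t. (cmod (g t))\<^sup>2" "fst n"]
  by (simp add: L2_norm_def gabor_def modulation_def translation_def norm_mult split_beta)

text \<open>Translation by \<open>a\<close> shifts the summation index, and the net of finite sets
  is invariant under this bijection of the integers. Modulation by \<open>b\<close> leaves a phase
  \<open>cis (- 2 * pi * b * j)\<close>, which is 1 for integers.\<close>

lemma has_zak_transform_gabor:
  assumes F: "has_zak_transform g F" and n: "n \<in> \<int> \<times> \<int>"
  shows "has_zak_transform (gabor g n) (char_mult F n)"
  unfolding has_zak_transform_iff
proof
  show "char_mult F n \<in> L2 lborel_Q" using F by (auto simp: has_zak_transform_iff intro: char_mult_L2)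
  obtain a b where ab: "n = (of_int a, of_int b)" using n by (cases n) (auto elim!: Ints_cases)
  have term_eq: "zak_term (gabor g n) j p = torus_char n p * zak_term g (j + a) p" for j p
  proof -
    obtain x \<xi> where p: "p = (x, \<xi>)" by (cases p)
    have "cis (2 * pi * of_int b * (x - of_int j)) * cis (2 * pi * of_int j * \<xi>)
        = cis (- 2 * pi * of_int (b * j)) * cis (2 * pi * (of_int b * x - of_int a * \<xi>)) * cis (2 * pi * of_int (j + a) * \<xi>)"
      by (simp add: cis_mult algebra_simps)
    also have "cis (- 2 * pi * of_int (b * j)) = 1"
      using cis_multiple_2pi[of "- of_int (b * j)"] by (simp add: algebra_simps)
    finally show ?thesis
      by (simp add: p ab zak_term_def torus_char_def gabor_def modulation_def translation_def algebra_simps)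
  qed
  have sum_eq: "zak_sum (gabor g n) J p = torus_char n p * zak_sum g ((\<lambda>j. j + a) ` J) p" for J p
    by (simp add: zak_sum_def term_eq sum_distrib_left sum.reindex)
  have "L2_norm lborel_Q (\<lambda>p. char_mult F n p - zak_sum (gabor g n) J p)
      = L2_norm lborel_Q (\<lambda>p. F p - zak_sum g ((\<lambda>j. j + a) ` J) p)" for J
    unfolding sum_eq char_mult_def right_diff_distrib[symmetric] by (rule L2_norm_cong) (simp add: norm_mult)
  moreover have "((\<lambda>J. L2_norm lborel_Q (\<lambda>p. F p - zak_sum g J p)) \<longlongrightarrow> 0)
      (filtermap ((`) (\<lambda>j. j + a)) (finite_subsets_at_top UNIV))"
  proof -
    have "surj (\<lambda>j. j + a)" by (metis diff_add_cancel surjI)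
    then show ?thesis
      using F by (subst filtermap_image_finite_subsets_at_top) (auto simp: has_zak_transform_iff)
  qed
  ultimately show "((\<lambda>J. L2_norm lborel_Q (\<lambda>p. char_mult F n p - zak_sum (gabor g n) J p)) \<longlongrightarrow> 0)
      (finite_subsets_at_top UNIV)"
    by (simp add: filterlim_filtermap)
qed

subsection \<open>The biorthogonal system\<close>

text \<open>The chord has length \<open>2 |sin ((s - t) / 2)|\<close> and is no longer than the
  arc.\<close>

lemma cmod_cis_diff_le: "cmod (cis s - cis t) \<le> \<bar>s - t\<bar>"
proof -
  have "(cmod (cis s - cis t))\<^sup>2 = (cos s - cos t)\<^sup>2 + (sin s - sin t)\<^sup>2"
    by (simp add: cmod_power2)
  also have "\<dots> = 2 - 2 * cos (s - t)"
    using sin_cos_squared_add[of s] sin_cos_squared_add[of t]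
    by (simp add: power2_diff cos_diff algebra_simps)
  also have "\<dots> = (2 * sin ((s - t) / 2))\<^sup>2"
  proof -
    have "cos (2 * ((s - t) / 2)) = 1 - 2 * (sin ((s - t) / 2))\<^sup>2" by (rule cos_double_sin)
    moreover have "2 * ((s - t) / 2) = s - t" by simp
    ultimately show ?thesis by (simp only: power_mult_distrib) simp
  qed
  also have "\<dots> = \<bar>2 * sin ((s - t) / 2)\<bar>\<^sup>2" by (rule power2_abs[symmetric])
  finally have "cmod (cis s - cis t) = \<bar>2 * sin ((s - t) / 2)\<bar>"
    by (rule power2_eq_imp_eq) (rule norm_ge_zero abs_ge_zero)+
  also have "\<dots> \<le> \<bar>s - t\<bar>"
    using abs_sin_x_le_abs_x[of "(s - t) / 2"] by (simp add: abs_mult)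
  finally show ?thesis .
qed

text \<open>A character difference divided by \<open>G\<close> is dominated by a multiple of
  \<open>rho / G\<close>, which puts the dual functions into \<open>L2\<close>. As the constant
  depends on \<open>n\<close>, their norms are not bounded uniformly this way.\<close>

lemma torus_char_Lipschitz:
  "cmod (torus_char n p - torus_char n q) \<le> 2 * pi * (\<bar>fst n\<bar> + \<bar>snd n\<bar>) * rho q p"
proof -
  obtain a b x \<xi> y \<eta> where eq: "n = (a, b)" "p = (x, \<xi>)" "q = (y, \<eta>)" by (cases n, cases p, cases q)
  have r: "\<bar>x - y\<bar> \<le> rho q p" "\<bar>\<xi> - \<eta>\<bar> \<le> rho q p"
    by (auto simp: rho_def eq intro: real_le_rsqrt)
  have "cmod (torus_char n p - torus_char n q) \<le> \<bar>2 * pi * (b * x - a * \<xi>) - 2 * pi * (b * y - a * \<eta>)\<bar>"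
    unfolding torus_char_def eq prod.case by (rule cmod_cis_diff_le)
  also have "2 * pi * (b * x - a * \<xi>) - 2 * pi * (b * y - a * \<eta>) = 2 * pi * (b * (x - y) - a * (\<xi> - \<eta>))"
    by (simp add: algebra_simps)
  also have "\<bar>\<dots>\<bar> = 2 * pi * \<bar>b * (x - y) - a * (\<xi> - \<eta>)\<bar>" by (simp add: abs_mult)
  also have "\<dots> \<le> 2 * pi * (\<bar>b\<bar> * \<bar>x - y\<bar> + \<bar>a\<bar> * \<bar>\<xi> - \<eta>\<bar>)"
    using abs_triangle_ineq4[of "b * (x - y)" "a * (\<xi> - \<eta>)"]
    by (intro mult_left_mono) (simp_all add: abs_mult)
  also have "\<dots> \<le> 2 * pi * (\<bar>b\<bar> * rho q p + \<bar>a\<bar> * rho q p)"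
    using r by (intro add_mono mult_left_mono) auto
  also have "\<dots> = 2 * pi * (\<bar>fst n\<bar> + \<bar>snd n\<bar>) * rho q p"
    by (simp add: eq(1) ring_distribs mult.assoc)
  finally show ?thesis .
qed

text \<open>The factor \<open>torus_char (m - n0) p0\<close> is the quotient of the characters
  \<open>m\<close> and \<open>n0\<close> at \<open>p0\<close>, so the numerator vanishes there. The
  denominator is \<open>cnj G\<close> because \<open>L2_inner\<close> conjugates its second
  argument, where it then cancels the \<open>G\<close> of \<open>char_mult G n\<close>.\<close>

definition dual_char :: "(real \<times> real \<Rightarrow> complex) \<Rightarrow> real \<times> real \<Rightarrow> real \<times> real \<Rightarrow>
    real \<times> real \<Rightarrow> real \<times> real \<Rightarrow> complex" where
  "dual_char G p0 n0 m p = (torus_char m p - torus_char (m - n0) p0 * torus_char n0 p) / cnj (G p)"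

text \<open>On the unit circle \<open>|w - 1|\<^sup>2 = 2 - 2 Re w\<close>, and the geometric sums
  of \<open>z \<noteq> 1\<close> are bounded by \<open>2 / |z - 1|\<close>, so their means vanish in
  the limit.\<close>

lemma Cesaro_mean_power:
  assumes "cmod z = 1" "z \<noteq> 1"
  shows "(\<lambda>N. (\<Sum>k<Suc N. (cmod (z ^ Suc k - 1))\<^sup>2) / real (Suc N)) \<longlonglongrightarrow> 2"
proof -
  have sq: "(cmod (w - 1))\<^sup>2 = 2 - 2 * Re w" if "cmod w = 1" for w
    using that cmod_power2[of w] by (simp add: cmod_power2 power2_diff)
  have sum: "(\<Sum>k<N. (cmod (z ^ Suc k - 1))\<^sup>2) = 2 * real N - 2 * Re (\<Sum>k<N. z ^ Suc k)" for N
    using assms(1) by (simp add: sq norm_power norm_mult sum_subtractf sum_distrib_left del: power_Suc)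
  have bd: "cmod (\<Sum>k<N. z ^ Suc k) \<le> 2 / cmod (z - 1)" for N
  proof -
    have "(\<Sum>k<N. z ^ Suc k) = z * ((z ^ N - 1) / (z - 1))"
      using assms(2) by (simp add: sum_distrib_left[symmetric] geometric_sum)
    moreover have "cmod (z ^ N - 1) \<le> 2"
      using norm_triangle_ineq4[of "z ^ N" 1] assms(1) by (simp add: norm_power)
    ultimately show ?thesis
      using assms by (simp add: norm_mult norm_divide divide_right_mono)
  qed
  have "(\<lambda>N. (\<Sum>k<Suc N. (cmod (z ^ Suc k - 1))\<^sup>2) / real (Suc N) - 2) \<longlonglongrightarrow> 0"
  proof (rule Lim_null_comparison)
    have "norm ((\<Sum>k<Suc N. (cmod (z ^ Suc k - 1))\<^sup>2) / real (Suc N) - 2) \<le> (4 / cmod (z - 1)) * inverse (real (Suc N))" for N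
    proof -
      have "(\<Sum>k<Suc N. (cmod (z ^ Suc k - 1))\<^sup>2) / real (Suc N) - 2 = - 2 * Re (\<Sum>k<Suc N. z ^ Suc k) / real (Suc N)"
        unfolding sum by (simp add: field_simps del: sum.lessThan_Suc power_Suc)
      then have "norm ((\<Sum>k<Suc N. (cmod (z ^ Suc k - 1))\<^sup>2) / real (Suc N) - 2)
          = 2 * \<bar>Re (\<Sum>k<Suc N. z ^ Suc k)\<bar> * inverse (real (Suc N))"
        by (simp add: abs_mult divide_inverse del: sum.lessThan_Suc power_Suc)
      also have "\<dots> \<le> 2 * (2 / cmod (z - 1)) * inverse (real (Suc N))"
        using order_trans[OF abs_Re_le_cmod bd[of "Suc N"]]
        by (intro mult_right_mono mult_left_mono) auto
      finally show ?thesis by simp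
    qed
    then show "\<forall>\<^sub>F N in sequentially. norm ((\<Sum>k<Suc N. (cmod (z ^ Suc k - 1))\<^sup>2) / real (Suc N) - 2)
        \<le> (4 / cmod (z - 1)) * inverse (real (Suc N))" by simp
    show "(\<lambda>N. (4 / cmod (z - 1)) * inverse (real (Suc N))) \<longlonglongrightarrow> 0"
      by (intro tendsto_mult_right_zero LIMSEQ_inverse_real_of_nat)
  qed
  then show ?thesis by (rule LIM_zero_cancel)
qed

lemma AE_fst_neq: "AE p in lborel_Q. fst p \<noteq> x"
proof -
  have "{x} \<times> UNIV \<in> null_sets (lborel \<Otimes>\<^sub>M lborel :: (real \<times> real) measure)"
    by (rule null_setsI) (auto simp: lborel.emeasure_pair_measure_Times)
  then have "AE p in lborel. p \<notin> {x} \<times> (UNIV :: real set)"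
    unfolding lborel_prod by (rule AE_not_in)
  then show ?thesis
    by (subst AE_restrict_space_iff) (auto elim!: eventually_mono simp: mem_Times_iff)
qed

lemma cmod_dual_char:
  "cmod (dual_char G p0 n0 m p) = cmod (torus_char (m - n0) p - torus_char (m - n0) p0) / cmod (G p)"
proof -
  have "torus_char m p - torus_char (m - n0) p0 * torus_char n0 p
      = (torus_char (m - n0) p - torus_char (m - n0) p0) * torus_char n0 p"
    using torus_char_add[of "m - n0" n0 p] by (simp add: algebra_simps)
  then show ?thesis by (simp add: dual_char_def norm_divide norm_mult)
qed

context
  fixes G :: "real \<times> real \<Rightarrow> complex" and p0 n0 :: "real \<times> real"
  assumes G: "G \<in> L2 lborel_Q" and rho_L2: "(\<lambda>p. of_real (rho p0 p) / G p) \<in> L2 lborel_Q"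
begin

lemma G_borel [measurable]: "G \<in> borel_measurable lborel_Q"
  using G by auto

lemma dual_char_measurable [measurable]: "dual_char G p0 n0 m \<in> borel_measurable lborel_Q"
  unfolding dual_char_def by measurable

lemma dual_char_L2: "dual_char G p0 n0 m \<in> L2 lborel_Q"
proof (rule L2_bound[OF dual_char_measurable L2_scale[OF rho_L2]])
  define C where "C = 2 * pi * (\<bar>fst (m - n0)\<bar> + \<bar>snd (m - n0)\<bar>)"
  have "cmod (dual_char G p0 n0 m p) \<le> cmod (of_real C * (of_real (rho p0 p) / G p))" for p
  proof -
    have "cmod (dual_char G p0 n0 m p) \<le> C * rho p0 p / cmod (G p)"
      unfolding cmod_dual_char C_def by (intro divide_right_mono torus_char_Lipschitz) simp
    also have "\<dots> \<le> \<bar>C * rho p0 p\<bar> / cmod (G p)" by (intro divide_right_mono) auto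
    finally show ?thesis by (simp add: norm_mult norm_divide abs_mult)
  qed
  then show "AE p in lborel_Q. cmod (dual_char G p0 n0 m p) \<le> cmod (of_real C * (of_real (rho p0 p) / G p))"
    by simp
qed

text \<open>After \<open>G\<close> cancels, two inner products of characters remain. The one coming
  from the correction is zero since \<open>n \<noteq> n0\<close>: this is what the removal of
  \<open>n0\<close> achieves.\<close>

lemma biorthogonal:
  assumes nz: "AE p in lborel_Q. G p \<noteq> 0" and n0: "n0 \<in> \<int> \<times> \<int>" and n: "n \<in> \<int> \<times> \<int> - {n0}" and m: "m \<in> \<int> \<times> \<int>"
  shows "L2_inner lborel_Q (char_mult G n) (dual_char G p0 n0 m) = (if n = m then 1 else 0)"
proof -
  let ?E = torus_char
  \<comment> \<open>The conjugate of the constant in \<open>dual_char\<close>, as it leaves the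
    second argument of the inner product.\<close>
  define \<kappa> where "\<kappa> = cnj (?E (m - n0) p0)"
  have "L2_inner lborel_Q (char_mult G n) (dual_char G p0 n0 m)
      = (\<integral>p. ?E n p * cnj (?E m p) - \<kappa> * (?E n p * cnj (?E n0 p)) \<partial>lborel_Q)"
    unfolding L2_inner_def
  proof (rule integral_cong_AE)
    show "AE p in lborel_Q. char_mult G n p * cnj (dual_char G p0 n0 m p)
        = ?E n p * cnj (?E m p) - \<kappa> * (?E n p * cnj (?E n0 p))"
      using nz by eventually_elim (simp add: char_mult_def dual_char_def \<kappa>_def field_simps)
    show "(\<lambda>p. char_mult G n p * cnj (dual_char G p0 n0 m p)) \<in> borel_measurable lborel_Q"
      unfolding char_mult_def by measurable
  qed measurable
  also have "\<dots> = L2_inner lborel_Q (?E n) (?E m) - \<kappa> * L2_inner lborel_Q (?E n) (?E n0)"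
    unfolding L2_inner_def using L2_mult_cnj_integrable[OF torus_char_L2 torus_char_L2] by simp
  also have "\<dots> = (if n = m then 1 else 0)"
    using n torus_char_orthonormal[of n m] torus_char_orthonormal[of n n0] m n0 by simp
  finally show ?thesis .
qed

lemma biorthogonal_sum:
  assumes nz: "AE p in lborel_Q. G p \<noteq> 0" and n0: "n0 \<in> \<int> \<times> \<int>"
    and J: "finite J" "J \<subseteq> \<int> \<times> \<int> - {n0}" and m: "m \<in> \<int> \<times> \<int>"
  shows "L2_inner lborel_Q (\<lambda>p. \<Sum>n\<in>J. c n * char_mult G n p) (dual_char G p0 n0 m) = (if m \<in> J then c m else 0)"
proof -
  have "L2_inner lborel_Q (\<lambda>p. \<Sum>n\<in>J. c n * char_mult G n p) (dual_char G p0 n0 m)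
      = (\<Sum>n\<in>J. c n * L2_inner lborel_Q (char_mult G n) (dual_char G p0 n0 m))"
    by (intro L2_inner_sum J(1) char_mult_L2 G dual_char_L2)
  also have "\<dots> = (\<Sum>n\<in>J. if n = m then c n else 0)"
  proof (rule sum.cong[OF refl])
    fix n assume "n \<in> J"
    then have "n \<in> \<int> \<times> \<int> - {n0}" using J(2) by blast
    from biorthogonal[OF nz n0 this m]
    show "c n * L2_inner lborel_Q (char_mult G n) (dual_char G p0 n0 m) = (if n = m then c n else 0)" by simp
  qed
  finally show ?thesis using J(1) by simp
qed

text \<open>
  For fixed \<open>p\<close> off a null set, the numerators \<open>|z\<^sup>k - 1|\<^sup>2\<close> of \<open>|dual_char|\<^sup>2\<close> along \<open>n0 + (0, k)\<close> have
  Cesaro mean \<open>2\<close>, because \<open>z = cis (2 \<pi> (x - x\<^sub>0)) \<noteq> 1\<close>. By Fatou's lemma a bound on the norms would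
  bound \<open>\<integral> 2 / |G|\<^sup>2\<close>.
\<close>

theorem dual_char_bounded_imp:
  assumes n0: "n0 \<in> \<int> \<times> \<int>" and p0: "p0 \<in> Q" and C: "\<And>m. m \<in> \<int> \<times> \<int> - {n0} \<Longrightarrow> L2_norm lborel_Q (dual_char G p0 n0 m) \<le> C"
  shows "(\<lambda>p. 1 / G p) \<in> L2 lborel_Q"
proof -
  define z where "z p = cis (2 * pi * (fst p - fst p0))" for p :: "real \<times> real"
  \<comment> \<open>Only the second index varies, so the modulus of the numerator is that of
    \<open>z p ^ Suc k - 1\<close> and depends on the first coordinate alone. \<open>Suc\<close>
    keeps the index away from \<open>n0\<close>.\<close>
  define m where "m k = n0 + (0, real (Suc k))" for k
  have m: "m k \<in> \<int> \<times> \<int> - {n0}" for k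
    using n0 by (auto simp: m_def mem_Times_iff prod_eq_iff)
  have dual: "(cmod (dual_char G p0 n0 (m k) p))\<^sup>2 = (cmod (z p ^ Suc k - 1))\<^sup>2 * (1 / (cmod (G p))\<^sup>2)" for k p
  proof -
    have "cis (2 * pi * (r * x)) = cis (2 * pi * (r * (x - y))) * cis (2 * pi * (r * y))" for r x y
      by (simp add: cis_mult algebra_simps)
    moreover have "z p ^ Suc k = cis (2 * pi * (real (Suc k) * (fst p - fst p0)))"
      unfolding z_def by (subst Complex.DeMoivre) (simp only: mult.left_commute)
    ultimately have "torus_char (0, real (Suc k)) p - torus_char (0, real (Suc k)) p0
        = (z p ^ Suc k - 1) * torus_char (0, real (Suc k)) p0"
      by (simp add: torus_char_def split_beta left_diff_distrib del: power_Suc of_nat_Suc)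
    then show ?thesis
      unfolding cmod_dual_char m_def by (simp add: norm_mult power_divide del: power_Suc)
  qed
  define A where "A N p = (\<Sum>k<Suc N. (cmod (dual_char G p0 n0 (m k) p))\<^sup>2) / real (Suc N)" for N p
  have [measurable]: "A N \<in> borel_measurable lborel_Q" for N unfolding A_def by measurable
  have A_int: "integrable lborel_Q (A N)" for N
    unfolding A_def using L2_integrable[OF dual_char_L2] by (intro integrable_divide Bochner_Integration.integrable_sum)
  have A_nonneg: "0 \<le> A N p" for N p unfolding A_def by (intro divide_nonneg_nonneg sum_nonneg) auto
  have A_le: "(\<integral>p. A N p \<partial>lborel_Q) \<le> C\<^sup>2" for N
  proof -
    have "(\<integral>p. A N p \<partial>lborel_Q) = (\<Sum>k<Suc N. (L2_norm lborel_Q (dual_char G p0 n0 (m k)))\<^sup>2) / real (Suc N)"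
      unfolding A_def L2_norm_square using L2_integrable[OF dual_char_L2]
      by (simp add: Bochner_Integration.integral_sum del: sum.lessThan_Suc of_nat_Suc)
    also have "\<dots> \<le> (\<Sum>k<Suc N. C\<^sup>2) / real (Suc N)"
      using C[OF m] by (intro divide_right_mono sum_mono power_mono) auto
    also have "\<dots> = C\<^sup>2" by simp
    finally show ?thesis .
  qed
  have lim: "AE p in lborel_Q. (\<lambda>N. A N p) \<longlonglongrightarrow> 2 * (1 / (cmod (G p))\<^sup>2)"
    using AE_fst_neq[of "fst p0"] AE_space[of lborel_Q]
  proof eventually_elim
    case (elim p)
    \<comment> \<open>Both points lie in \<open>Q\<close>, so their first coordinates differ by less
      than 1; an integer difference would be 0, which the excluded null line forbids.\<close>
    have "z p \<noteq> 1"
    proof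
      assume "z p = 1"
      then obtain i :: int where "2 * pi * (fst p - fst p0) = of_int (2 * i) * pi"
        unfolding z_def cis_conv_exp exp_eq_1 by auto
      then have i: "fst p - fst p0 = of_int i" by simp
      have "\<bar>fst p - fst p0\<bar> < 1"
      proof -
        have "p \<in> Q" using elim(2) by (simp only: space_lborel_Q)
        with p0 show ?thesis by (auto simp: Q_def)
      qed
      with i have "i = 0" by linarith
      with i elim(1) show False by simp
    qed
    from Cesaro_mean_power[OF _ this]
    have "(\<lambda>N. (\<Sum>k<Suc N. (cmod (z p ^ Suc k - 1))\<^sup>2) / real (Suc N)) \<longlonglongrightarrow> 2" by (simp add: z_def)
    from tendsto_mult_right[OF this, of "1 / (cmod (G p))\<^sup>2"]
    show ?case
      unfolding A_def dual sum_distrib_right[symmetric] by (simp add: field_simps)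
  qed
  have "(\<integral>\<^sup>+p. ennreal (2 * (1 / (cmod (G p))\<^sup>2)) \<partial>lborel_Q) = (\<integral>\<^sup>+p. liminf (\<lambda>N. ennreal (A N p)) \<partial>lborel_Q)"
  proof (rule nn_integral_cong_AE)
    show "AE p in lborel_Q. ennreal (2 * (1 / (cmod (G p))\<^sup>2)) = liminf (\<lambda>N. ennreal (A N p))"
      using lim
    proof eventually_elim
      case (elim p)
      from tendsto_ennrealI[OF this] show ?case
        by (intro lim_imp_Liminf[symmetric]) auto
    qed
  qed
  also have "\<dots> \<le> liminf (\<lambda>N. \<integral>\<^sup>+p. ennreal (A N p) \<partial>lborel_Q)"
    by (rule nn_integral_liminf) measurable
  also have "\<dots> \<le> liminf (\<lambda>N. ennreal (C\<^sup>2))"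
    using A_le by (intro Liminf_mono always_eventually allI)
      (simp add: nn_integral_eq_integral[OF A_int] A_nonneg ennreal_leI)
  also have "\<dots> = ennreal (C\<^sup>2)" by (simp add: Liminf_const)
  finally have "(\<integral>\<^sup>+p. ennreal (2 * (1 / (cmod (G p))\<^sup>2)) \<partial>lborel_Q) < \<infinity>"
    by (simp add: le_less_trans)
  then have "integrable lborel_Q (\<lambda>p. 2 * (1 / (cmod (G p))\<^sup>2))"
    by (intro integrableI_nonneg) auto
  then have "integrable lborel_Q (\<lambda>p. 2 * (1 / (cmod (G p))\<^sup>2) / 2)" by (rule integrable_divide)
  then have "integrable lborel_Q (\<lambda>p. 1 / (cmod (G p))\<^sup>2)" by simp
  then show ?thesis by (intro L2_I) (auto simp: norm_divide power_divide)
qed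

end

subsection \<open>The Gabor system\<close>

context
  fixes g :: "real \<Rightarrow> complex" and G :: "real \<times> real \<Rightarrow> complex" and p0 n0 :: "real \<times> real"
  assumes g: "g \<in> L2 lborel" and gG: "has_zak_transform g G"
    and nz: "AE p in lborel_Q. G p \<noteq> 0" and not_L2: "(\<lambda>p. 1 / G p) \<notin> L2 lborel_Q"
    and rho_L2: "(\<lambda>p. of_real (rho p0 p) / G p) \<in> L2 lborel_Q"
    and n0: "n0 \<in> \<int> \<times> \<int>" and p0: "p0 \<in> Q"
begin

lemma G_L2: "G \<in> L2 lborel_Q"
  using gG by (simp add: has_zak_transform_iff)

lemma zak_gabor_sum:
  assumes "finite J" "J \<subseteq> \<int> \<times> \<int>"
  shows "has_zak_transform (\<lambda>x. \<Sum>n\<in>J. c n * gabor g n x) (\<lambda>p. \<Sum>n\<in>J. c n * char_mult G n p)"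
  using assms by (intro has_zak_transform_sum gabor_L2 g has_zak_transform_gabor gG) auto

lemma gabor_sum_L2: "(\<lambda>x. \<Sum>n\<in>J. c n * gabor g n x) \<in> L2 lborel"
  by (intro L2_sum L2_scale gabor_L2 g)

lemma char_mult_sum_L2: "(\<lambda>p. \<Sum>n\<in>J. c n * char_mult G n p) \<in> L2 lborel_Q"
  by (intro L2_sum L2_scale char_mult_L2 G_L2)

text \<open>Linearity and isometry match every approximation error on the line with one on the
  square. Density, distance and convergence statements transfer through this identity.\<close>

lemma zak_gabor_approx:
  assumes f: "f \<in> L2 lborel" "has_zak_transform f F" and J: "finite J" "J \<subseteq> \<int> \<times> \<int>"
  shows "L2_norm lborel (\<lambda>x. f x - (\<Sum>n\<in>J. c n * gabor g n x))
    = L2_norm lborel_Q (\<lambda>p. F p - (\<Sum>n\<in>J. c n * char_mult G n p))"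
  using zak_isometry[OF L2_diff[OF f(1) gabor_sum_L2]
      has_zak_transform_diff[OF f gabor_sum_L2 zak_gabor_sum[OF J]]] by simp

lemma gabor_complete: "complete_system lborel (\<int> \<times> \<int> - {n0}) (gabor g)"
  unfolding complete_system_def
proof (intro equalityI subsetI)
  fix f :: "real \<Rightarrow> complex" assume f: "f \<in> L2 lborel"
  then obtain F where F: "has_zak_transform f F" using has_zak_transform_exists by blast
  then have "F \<in> L2 lborel_Q" by (simp add: has_zak_transform_iff)
  then have F_span: "F \<in> closed_span lborel_Q (\<int> \<times> \<int> - {n0}) (char_mult G)"
    by (rule char_mult_complete[OF G_L2 nz not_L2 n0])
  show "f \<in> closed_span lborel (\<int> \<times> \<int> - {n0}) (gabor g)"
    unfolding closed_span_def
  proof (intro CollectI conjI f allI impI)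
    fix \<epsilon> :: real assume "\<epsilon> > 0"
    then obtain J c where J: "finite J" "J \<subseteq> \<int> \<times> \<int> - {n0}"
        "L2_norm lborel_Q (\<lambda>p. F p - (\<Sum>n\<in>J. c n * char_mult G n p)) < \<epsilon>"
      using F_span unfolding closed_span_def by blast
    moreover have "J \<subseteq> \<int> \<times> \<int>" using J(2) by blast
    ultimately show "\<exists>J c. finite J \<and> J \<subseteq> \<int> \<times> \<int> - {n0} \<and>
        L2_norm lborel (\<lambda>x. f x - (\<Sum>n\<in>J. c n * gabor g n x)) < \<epsilon>"
      using zak_gabor_approx[OF f F] by (intro exI[of _ J] exI[of _ c]) simp
  qed
qed (simp add: closed_span_def)

text \<open>The dual function of index \<open>m\<close> pairs to 1 with the element \<open>m\<close>
  and to 0 with the others. By Cauchy-Schwarz this keeps the element at a positive distance from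
  their span.\<close>

lemma gabor_minimal: "minimal_system lborel (\<int> \<times> \<int> - {n0}) (gabor g)"
  unfolding minimal_system_def
proof (intro ballI notI)
  fix m assume m: "m \<in> \<int> \<times> \<int> - {n0}"
    and span: "gabor g m \<in> closed_span lborel (\<int> \<times> \<int> - {n0} - {m}) (gabor g)"
  let ?h = "dual_char G p0 n0 m"
  note h = dual_char_L2[OF G_L2 rho_L2, of n0 m]
  \<comment> \<open>The added 1 avoids a division by zero and makes the final inequality
    strict.\<close>
  define \<epsilon> where "\<epsilon> = 1 / (L2_norm lborel_Q ?h + 1)"
  have "\<epsilon> > 0" by (simp add: \<epsilon>_def add_nonneg_pos)
  then obtain J c where J: "finite J" "J \<subseteq> \<int> \<times> \<int> - {n0} - {m}"
      "L2_norm lborel (\<lambda>x. gabor g m x - (\<Sum>n\<in>J. c n * gabor g n x)) < \<epsilon>"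
    using span unfolding closed_span_def by blast
  have J': "J \<subseteq> \<int> \<times> \<int>" "J \<subseteq> \<int> \<times> \<int> - {n0}" using J(2) by auto
  have m': "m \<in> \<int> \<times> \<int>" using m by blast
  have lt: "L2_norm lborel_Q (\<lambda>p. char_mult G m p - (\<Sum>n\<in>J. c n * char_mult G n p)) < \<epsilon>"
    using J(3) zak_gabor_approx[OF gabor_L2[OF g] has_zak_transform_gabor[OF gG m'] J(1) J'(1)] by simp
  have "L2_inner lborel_Q (\<lambda>p. char_mult G m p - (\<Sum>n\<in>J. c n * char_mult G n p)) ?h = 1"
    using biorthogonal_sum[OF G_L2 rho_L2 nz n0 J(1) J'(2) m', of c] biorthogonal[OF G_L2 rho_L2 nz n0 m m'] J(2)
    by (subst L2_inner_diff[OF char_mult_L2[OF G_L2] char_mult_sum_L2 h]) auto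
  then have "1 \<le> L2_norm lborel_Q (\<lambda>p. char_mult G m p - (\<Sum>n\<in>J. c n * char_mult G n p)) * L2_norm lborel_Q ?h"
    using L2_inner_le[OF L2_diff[OF char_mult_L2[OF G_L2] char_mult_sum_L2] h, of m c J] by simp
  also have "\<dots> \<le> \<epsilon> * L2_norm lborel_Q ?h"
    using lt by (intro mult_right_mono) auto
  also have "\<dots> < 1"
  proof -
    have "1 / (y + 1) * y < 1" if "y \<ge> 0" for y :: real using that by (simp add: field_simps)
    from this[OF L2_norm_nonneg] show ?thesis unfolding \<epsilon>_def .
  qed
  finally show False by simp
qed

text \<open>Completeness on the square approximates \<open>F\<close> by images of finite Gabor sums;
  by isometry the sums converge geometrically fast, and their limit is the preimage. Since functions
  are not identified, \<open>F\<close> is reached only up to distance 0.\<close>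

lemma zak_almost_surjective:
  assumes F: "F \<in> L2 lborel_Q"
  shows "\<exists>f F'. f \<in> L2 lborel \<and> has_zak_transform f F' \<and> L2_norm lborel_Q (\<lambda>p. F p - F' p) = 0"
proof -
  have "F \<in> closed_span lborel_Q (\<int> \<times> \<int> - {n0}) (char_mult G)"
    by (rule char_mult_complete[OF G_L2 nz not_L2 n0 F])
  then have "\<forall>k. \<exists>J c. finite J \<and> J \<subseteq> \<int> \<times> \<int> - {n0} \<and>
      L2_norm lborel_Q (\<lambda>p. F p - (\<Sum>n\<in>J. c n * char_mult G n p)) < (1/2) ^ k"
    unfolding closed_span_def by simp
  from choice[OF this] obtain J where "\<forall>k. \<exists>c. finite (J k) \<and> J k \<subseteq> \<int> \<times> \<int> - {n0} \<and>
      L2_norm lborel_Q (\<lambda>p. F p - (\<Sum>n\<in>J k. c n * char_mult G n p)) < (1/2) ^ k" ..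
  from choice[OF this] obtain c where "\<forall>k. finite (J k) \<and> J k \<subseteq> \<int> \<times> \<int> - {n0} \<and>
      L2_norm lborel_Q (\<lambda>p. F p - (\<Sum>n\<in>J k. c k n * char_mult G n p)) < (1/2) ^ k" ..
  then have J: "\<And>k. finite (J k)" "\<And>k. J k \<subseteq> \<int> \<times> \<int> - {n0}"
    and lt: "\<And>k. L2_norm lborel_Q (\<lambda>p. F p - (\<Sum>n\<in>J k. c k n * char_mult G n p)) < (1/2) ^ k"
    by blast+
  have J': "J k \<subseteq> \<int> \<times> \<int>" for k using J(2) by blast
  define f where "f k x = (\<Sum>n\<in>J k. c k n * gabor g n x)" for k x
  define F' where "F' k p = (\<Sum>n\<in>J k. c k n * char_mult G n p)" for k p
  have f: "f k \<in> L2 lborel" and F': "F' k \<in> L2 lborel_Q" for k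
    unfolding f_def[abs_def] F'_def[abs_def] by (rule gabor_sum_L2 char_mult_sum_L2)+
  have zak: "has_zak_transform (f k) (F' k)" for k
    unfolding f_def[abs_def] F'_def[abs_def] by (rule zak_gabor_sum[OF J(1) J'])
  have near: "L2_norm lborel_Q (\<lambda>p. F p - F' k p) < (1/2) ^ k" for k using lt by (simp add: F'_def)
  have "L2_norm lborel (\<lambda>x. f (Suc k) x - f k x) \<le> 2 * (1/2) ^ k" for k
  proof -
    have "L2_norm lborel (\<lambda>x. f (Suc k) x - f k x) = L2_norm lborel_Q (\<lambda>p. F' (Suc k) p - F' k p)"
      by (rule zak_isometry[OF L2_diff[OF f f] has_zak_transform_diff[OF f zak f zak], symmetric])
    also have "\<dots> \<le> L2_norm lborel_Q (\<lambda>p. F' (Suc k) p - F p) + L2_norm lborel_Q (\<lambda>p. F p - F' k p)"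
      by (intro L2_norm_triangle_diff F F')
    also have "\<dots> \<le> (1/2) ^ Suc k + (1/2) ^ k"
      using near[of k] near[of "Suc k"] by (simp add: L2_norm_minus_commute[of _ _ F])
    also have "\<dots> \<le> 2 * (1/2) ^ k" by simp
    finally show ?thesis .
  qed
  moreover have "summable (\<lambda>k. 2 * (1/2) ^ k :: real)" by (intro summable_mult summable_geometric) simp
  ultimately obtain h where h: "h \<in> L2 lborel" and lim: "(\<lambda>k. L2_norm lborel (\<lambda>x. f k x - h x)) \<longlonglongrightarrow> 0"
    using L2_complete[of f lborel "\<lambda>k. 2 * (1/2) ^ k"] f by blast
  obtain H where H: "has_zak_transform h H" using has_zak_transform_exists[OF h] by blast
  then have H_L2: "H \<in> L2 lborel_Q" by (simp add: has_zak_transform_iff)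
  have "L2_norm lborel_Q (\<lambda>p. F p - H p) \<le> (1/2) ^ k + L2_norm lborel (\<lambda>x. f k x - h x)" for k
  proof -
    have "L2_norm lborel_Q (\<lambda>p. F' k p - H p) = L2_norm lborel (\<lambda>x. f k x - h x)"
      by (rule zak_isometry[OF L2_diff[OF f h] has_zak_transform_diff[OF f zak h H]])
    with L2_norm_triangle_diff[OF F F' H_L2, of k] near[of k] show ?thesis by simp
  qed
  moreover have "(\<lambda>k. (1/2) ^ k + L2_norm lborel (\<lambda>x. f k x - h x)) \<longlonglongrightarrow> 0 + 0"
    by (intro tendsto_add lim LIMSEQ_realpow_zero) auto
  ultimately have "L2_norm lborel_Q (\<lambda>p. F p - H p) \<le> 0"
    by (intro LIMSEQ_le_const[of _ 0]) auto
  with h H show ?thesis by (intro exI[of _ h] exI[of _ H]) (simp add: order_antisym)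
qed

text \<open>\<open>G\<close> is nonzero almost everywhere on a set of measure 1. The common norm of
  the Gabor elements is the divisor in the bound on basis coefficients.\<close>

lemma gabor_norm_pos: "L2_norm lborel g > 0"
proof -
  have "L2_norm lborel_Q G \<noteq> 0"
  proof
    assume "L2_norm lborel_Q G = 0"
    then have "AE p in lborel_Q. G p = 0" using L2_norm_zero_iff[OF G_L2] by simp
    with nz have "AE p in lborel_Q. False" by eventually_elim simp
    then have "emeasure lborel_Q {p \<in> space lborel_Q. True} = 0" by (intro emeasure_eq_0_AE) simp
    then have "emeasure lborel_Q Q = 0" by (simp only: simp_thms Collect_mem_eq space_lborel_Q)
    with emeasure_lborel_Q show False by simp
  qed
  then show ?thesis using zak_isometry[OF g gG] L2_norm_nonneg[of lborel g] by (simp add: less_le)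
qed

lemma gabor_not_Schauder:
  assumes \<sigma>: "bij_betw \<sigma> (UNIV :: nat set) (\<int> \<times> \<int> - {n0})"
  shows "\<not> schauder_basis_wrt lborel \<sigma> (gabor g)"
proof
  assume basis: "schauder_basis_wrt lborel \<sigma> (gabor g)"
  let ?I = "\<int> \<times> \<int> - {n0}" and ?h = "dual_char G p0 n0"
  note h = dual_char_L2[OF G_L2 rho_L2, of n0]
  have \<sigma>_I: "\<sigma> k \<in> ?I" for k using \<sigma> by (auto simp: bij_betw_def)
  have \<sigma>_sub: "\<sigma> ` A \<subseteq> ?I" "\<sigma> ` A \<subseteq> \<int> \<times> \<int>" for A using \<sigma>_I by blast+
  have \<sigma>_inj: "inj \<sigma>" using \<sigma> by (simp add: bij_betw_def)
  have "\<exists>C. \<forall>m\<in>?I. L2_norm lborel_Q (?h m) \<le> C"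
  proof (rule L2_uniform_boundedness[OF h])
    fix F assume F: "F \<in> L2 lborel_Q"
    obtain f F' where f: "f \<in> L2 lborel" "has_zak_transform f F'"
      and FF': "L2_norm lborel_Q (\<lambda>p. F p - F' p) = 0"
      using zak_almost_surjective[OF F] by blast
    have F': "F' \<in> L2 lborel_Q" using f(2) by (simp add: has_zak_transform_iff)
    \<comment> \<open>\<open>F\<close> and \<open>F'\<close> are at distance 0, so by Cauchy-Schwarz
      they have the same pairings.\<close>
    have inner_eq: "L2_inner lborel_Q F (?h m) = L2_inner lborel_Q F' (?h m)" for m
      using L2_inner_le[OF L2_diff[OF F F'] h, of m] FF' by (simp add: L2_inner_diff[OF F F' h])
    obtain c where c: "(\<lambda>N. L2_norm lborel (\<lambda>x. f x - (\<Sum>n<N. c n * gabor g (\<sigma> n) x))) \<longlonglongrightarrow> 0"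
      using basis f(1) unfolding schauder_basis_wrt_def by blast
    define d where "d N = L2_norm lborel (\<lambda>x. f x - (\<Sum>n<N. c n * gabor g (\<sigma> n) x))" for N
    have d_lim: "d \<longlonglongrightarrow> 0" using c by (simp add: d_def[abs_def])
    \<comment> \<open>Coefficients are moved from positions to indices, because
      \<open>biorthogonal_sum\<close> works with finite sets of indices.\<close>
    define c' where "c' = c \<circ> inv \<sigma>"
    have reindex: "(\<Sum>n<N. c n * \<phi> (\<sigma> n)) = (\<Sum>n\<in>\<sigma> ` {..<N}. c' n * \<phi> n)" for N and \<phi> :: "real \<times> real \<Rightarrow> complex"
      using \<sigma>_inj by (subst sum.reindex) (auto simp: c'_def inj_on_def inv_f_f)
    have d_eq: "d N = L2_norm lborel_Q (\<lambda>p. F' p - (\<Sum>n\<in>\<sigma> ` {..<N}. c' n * char_mult G n p))" for N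
      unfolding d_def reindex[of "\<lambda>n. gabor g n _"]
      by (intro zak_gabor_approx f \<sigma>_sub) simp
    \<comment> \<open>As soon as \<open>N > k\<close>, the partial sum contains the index
      \<open>\<sigma> k\<close> and pairs to exactly \<open>c k\<close>. The remaining error is
      controlled by \<open>d N\<close>, so the coefficients are the pairings with the dual
      functions.\<close>
    have coeff: "L2_inner lborel_Q F' (?h (\<sigma> k)) = c k" for k
    proof -
      have "(\<lambda>N. L2_inner lborel_Q F' (?h (\<sigma> k)) - c k) \<longlonglongrightarrow> 0"
      proof (rule Lim_null_comparison)
        show "(\<lambda>N. d N * L2_norm lborel_Q (?h (\<sigma> k))) \<longlonglongrightarrow> 0"
          by (rule tendsto_mult_left_zero[OF d_lim])
        have "norm (L2_inner lborel_Q F' (?h (\<sigma> k)) - c k) \<le> d N * L2_norm lborel_Q (?h (\<sigma> k))" if "N > k" for N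
        proof -
          have "L2_inner lborel_Q (\<lambda>p. \<Sum>n\<in>\<sigma> ` {..<N}. c' n * char_mult G n p) (?h (\<sigma> k)) = c' (\<sigma> k)"
            using that \<sigma>_I[of k] by (subst biorthogonal_sum[OF G_L2 rho_L2 nz n0 _ \<sigma>_sub(1)]) auto
          moreover have "c' (\<sigma> k) = c k" using \<sigma>_inj by (simp add: c'_def)
          ultimately have "L2_inner lborel_Q F' (?h (\<sigma> k)) - c k
              = L2_inner lborel_Q (\<lambda>p. F' p - (\<Sum>n\<in>\<sigma> ` {..<N}. c' n * char_mult G n p)) (?h (\<sigma> k))"
            by (simp add: L2_inner_diff[OF F' char_mult_sum_L2 h])
          then show ?thesis
            unfolding d_eq using L2_inner_le[OF L2_diff[OF F' char_mult_sum_L2] h] by simp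
        qed
        then show "\<forall>\<^sub>F N in sequentially. norm (L2_inner lborel_Q F' (?h (\<sigma> k)) - c k)
            \<le> d N * L2_norm lborel_Q (?h (\<sigma> k))"
          by (intro eventually_sequentiallyI[of "Suc k"]) simp
      qed
      then show ?thesis by (simp add: tendsto_const_iff)
    qed
    have "Bseq d" using d_lim by (intro convergent_imp_Bseq convergentI)
    then obtain D where "\<forall>N. norm (d N) \<le> D" by (auto simp: Bseq_def)
    then have D: "d N \<le> D" for N using abs_le_D1[of "d N" D] by simp
    \<comment> \<open>A single term is the difference of consecutive partial sums, each within
      \<open>D\<close> of \<open>f\<close>. All elements have the norm of \<open>g\<close>, so one
      bound serves every \<open>k\<close>.\<close>
    have c_bd: "cmod (c k) \<le> 2 * D / L2_norm lborel g" for k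
    proof -
      define s where "s N x = (\<Sum>n<N. c n * gabor g (\<sigma> n) x)" for N x
      have s: "s N \<in> L2 lborel" for N
        unfolding s_def[abs_def] by (intro L2_sum L2_scale gabor_L2 g)
      have "cmod (c k) * L2_norm lborel g = L2_norm lborel (\<lambda>x. c k * gabor g (\<sigma> k) x)"
        by (simp add: L2_norm_scale gabor_norm)
      also have "\<dots> = L2_norm lborel (\<lambda>x. s (Suc k) x - s k x)" by (simp add: s_def)
      also have "\<dots> \<le> L2_norm lborel (\<lambda>x. s (Suc k) x - f x) + L2_norm lborel (\<lambda>x. f x - s k x)"
        by (intro L2_norm_triangle_diff s f)
      also have "\<dots> = d (Suc k) + d k"
        unfolding d_def s_def by (subst L2_norm_minus_commute) simp
      also have "\<dots> \<le> 2 * D" using D[of k] D[of "Suc k"] by simp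
      finally show ?thesis using gabor_norm_pos by (simp add: field_simps)
    qed
    show "\<exists>C. \<forall>m\<in>?I. cmod (L2_inner lborel_Q F (?h m)) \<le> C"
    proof (intro exI ballI)
      fix m assume "m \<in> ?I"
      then obtain k where "m = \<sigma> k" using \<sigma> by (auto simp: bij_betw_def)
      then show "cmod (L2_inner lborel_Q F (?h m)) \<le> 2 * D / L2_norm lborel g"
        using c_bd by (simp add: inner_eq coeff)
    qed
  qed
  then obtain C where "\<And>m. m \<in> ?I \<Longrightarrow> L2_norm lborel_Q (?h m) \<le> C" by blast
  from dual_char_bounded_imp[OF G_L2 rho_L2 n0 p0 this] not_L2 show False by blast
qed

end

theorem theorem4p2:
  fixes g :: "real \<Rightarrow> complex"
  assumes "g \<in> L2 lborel"
    and "\<not> quotient_in_L2 lborel_Q (\<lambda>p. 1) (zak g)"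
    and "\<exists>p\<^sub>0\<in>Q. quotient_in_L2 lborel_Q (\<lambda>p. of_real (rho p\<^sub>0 p)) (zak g)"
  shows "\<forall>a\<in>\<int>. \<forall>b\<in>\<int>.
      exact_system lborel (\<int> \<times> \<int> - {(a, b)}) (gabor g) \<and>
      \<not> (\<exists>\<sigma>. bij_betw \<sigma> (UNIV :: nat set) (\<int> \<times> \<int> - {(a, b)}) \<and>
            schauder_basis_wrt lborel \<sigma> (gabor g))"
proof (intro ballI)
  fix a b :: real assume "a \<in> \<int>" "b \<in> \<int>"
  then have n0: "(a, b) \<in> \<int> \<times> \<int>" by simp
  \<comment> \<open>\<open>zak g\<close> is a chosen representative; existence makes the choice
    meaningful, and the preceding results apply to any representative.\<close>
  have zak: "has_zak_transform g (zak g)"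
    unfolding zak_def by (rule someI_ex[OF has_zak_transform_exists[OF assms(1)]])
  obtain p0 where p0: "p0 \<in> Q" and nz: "AE p in lborel_Q. zak g p \<noteq> 0"
    and rho_L2: "(\<lambda>p. of_real (rho p0 p) / zak g p) \<in> L2 lborel_Q"
    using assms(3) by (auto simp: quotient_in_L2_def)
  \<comment> \<open>A quotient can fail to be in \<open>L2\<close> through a vanishing denominator
    or through non-integrability. The hypothesis on \<open>rho\<close> excludes the former.\<close>
  have not_L2: "(\<lambda>p. 1 / zak g p) \<notin> L2 lborel_Q"
    using assms(2) nz by (simp add: quotient_in_L2_def)
  note facts = assms(1) zak nz not_L2 rho_L2 n0 p0
  show "exact_system lborel (\<int> \<times> \<int> - {(a, b)}) (gabor g) \<and>
      \<not> (\<exists>\<sigma>. bij_betw \<sigma> (UNIV :: nat set) (\<int> \<times> \<int> - {(a, b)}) \<and>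
            schauder_basis_wrt lborel \<sigma> (gabor g))"
    unfolding exact_system_def
    using gabor_complete[OF facts] gabor_minimal[OF facts] gabor_not_Schauder[OF facts] gabor_L2[OF assms(1)]
    by blast
qed

end
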